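(* Let $r\in\mathbb{Z}_{\ge0}$ be fixed and let $X_{n,r}$ be the size of $\rho^{r}(\tau)$ for a uniformly random Catalan--Stanley tree $\tau$ of size $n$. As $n\to\infty$, \[ \mathbb{E}X_{n,r} = \frac{1}{4^{r}}n + \frac{2\cdot4^{r}-2r^{2}+r-2}{2\cdot4^{r}} + \frac{(2r+1)(2r-1)(r-3)r}{2\cdot4^{r+1}}n^{-1} + O(n^{-3/2}), \] \begin{multline*} \mathbb{V}X_{n,r} = \frac{(2^{r}+1)(2^{r}-1)}{16^{r}}n^{2} - \frac{\sqrt{\pi}\,(4^{r}(3r+1)-1)}{3\cdot16^{r}}n^{3/2} + \frac{18\cdot4^{r}r^{2}+3\cdot4^{r}r-38\cdot4^{r}+36r^{2}-42r+38}{18\cdot16^{r}}n\\ + \frac{5\sqrt{\pi}\,(4^{r}(3r+1)-1)}{8\cdot16^{r}}n^{1/2} + O(1). \end{multline*}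
   Context: A rooted plane tree has ordered children at every node; its size is its number of nodes. For each child $c$ of the root, the rightmost leaf of the branch at $c$ is the leaf reached from $c$ by repeatedly moving to the rightmost child. A Catalan--Stanley tree is a rooted plane tree in which every such rightmost leaf has odd distance to the root (the one-node tree is included). The reduction $\rho$: for each rightmost leaf $\ell$ of a branch attached to the root, if $\ell$ is a child of the root it is deleted; otherwise all descendants of the grandparent of $\ell$ are deleted (the grandparent becomes a leaf); the one-node tree is mapped to itself. $\rho^r(\tau)$ is the $r$th ancestor of $\tau$; $\rho^0$ is the identity. *)

theory Defs
  imports "HOL-Probability.Probability" "HOL-Library.Landau_Symbols"
begin

datatype plane_tree = PNode (children: "plane_tree list")

fun num_nodes :: "plane_tree \<Rightarrow> nat" where
  "num_nodes (PNode ts) = 1 + sum_list (map num_nodes ts)"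

text \<open>
  The number of edges between the root of the given tree and its rightmost leaf, i.e. the leaf
  reached by repeatedly moving to the rightmost child.
\<close>
function rightmost_depth :: "plane_tree \<Rightarrow> nat" where
  "rightmost_depth (PNode ts) = (if ts = [] then 0 else 1 + rightmost_depth (last ts))"
  by pat_completeness auto
termination
  by (relation "Wellfounded.measure size") (auto simp: less_Suc_eq_le intro!: size_list_estimation'[OF last_in_set])

text \<open>
  The rightmost leaf of the branch at a child \<open>c\<close> of the root has distance
  \<open>1 + rightmost_depth c\<close> to the root of the whole tree.
\<close>
definition catalan_stanley :: "plane_tree \<Rightarrow> bool" where
  "catalan_stanley t \<longleftrightarrow> (\<forall>c \<in> set (children t). odd (1 + rightmost_depth c))"

definition catalan_stanley_trees :: "nat \<Rightarrow> plane_tree set" where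
  "catalan_stanley_trees n = {t. catalan_stanley t \<and> num_nodes t = n}"

text \<open>
  Follow the rightmost path for \<open>k\<close> steps and delete all descendants of the node reached.
\<close>
fun cut_rightmost :: "nat \<Rightarrow> plane_tree \<Rightarrow> plane_tree" where
  "cut_rightmost 0 t = PNode []"
| "cut_rightmost (Suc k) (PNode ts) = PNode (butlast ts @ [cut_rightmost k (last ts)])"

text \<open>
  A child \<open>c\<close> of the root with \<open>rightmost_depth c = 0\<close> is itself the rightmost leaf of its branch and
  is deleted. In a Catalan--Stanley tree every other child has even \<open>rightmost_depth c \<ge> 2\<close>, so that
  the grandparent of the rightmost leaf is reached from \<open>c\<close> by \<open>rightmost_depth c - 2\<close> steps along
  the rightmost path. The value on trees that are not Catalan--Stanley trees is irrelevant.
\<close>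
definition reduction :: "plane_tree \<Rightarrow> plane_tree" where
  "reduction t =
     PNode (map (\<lambda>c. cut_rightmost (rightmost_depth c - 2) c)
             (filter (\<lambda>c. rightmost_depth c \<noteq> 0) (children t)))"

definition ancestor_size :: "nat \<Rightarrow> plane_tree \<Rightarrow> real" where
  "ancestor_size r t = real (num_nodes ((reduction ^^ r) t))"

definition random_cs_tree :: "nat \<Rightarrow> plane_tree pmf" where
  "random_cs_tree n = pmf_of_set (catalan_stanley_trees n)"

lemma reduction_single: "reduction (PNode []) = PNode []"
  by (simp add: reduction_def)

lemma rightmost_depth_cut:
  "k \<le> rightmost_depth t \<Longrightarrow> rightmost_depth (cut_rightmost k t) = k"
  by (induction k t rule: cut_rightmost.induct) (auto split: if_splits)

lemma catalan_stanley_reduction: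
  assumes "catalan_stanley t"
  shows "catalan_stanley (reduction t)"
  using assms by (auto simp: catalan_stanley_def reduction_def rightmost_depth_cut)

lemma catalan_stanley_ancestor:
  "catalan_stanley t \<Longrightarrow> catalan_stanley ((reduction ^^ r) t)"
  by (induction r) (auto intro: catalan_stanley_reduction)

lemma num_nodes_pos: "num_nodes t > 0"
  by (cases t) simp

lemma length_le_sum_num_nodes: "length ts \<le> sum_list (map num_nodes ts)"
proof (induction ts)
  case (Cons t ts)
  then show ?case using num_nodes_pos[of t] by simp
qed simp

lemma finite_trees_of_bounded_size: "finite {t. num_nodes t \<le> n}"
proof (induction n)
  case 0
  have "\<not> num_nodes t \<le> 0" for t using num_nodes_pos[of t] by simp
  then have "{t. num_nodes t \<le> 0} = {}" by blast
  then show ?case by (metis finite.emptyI)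
next
  case (Suc n)
  have "{t. num_nodes t \<le> Suc n} \<subseteq>
          PNode ` {ts. set ts \<subseteq> {t. num_nodes t \<le> n} \<and> length ts \<le> n}"
  proof
    fix t assume "t \<in> {t. num_nodes t \<le> Suc n}"
    moreover obtain ts where t: "t = PNode ts" by (cases t)
    ultimately have s: "sum_list (map num_nodes ts) \<le> n" by simp
    have "num_nodes c \<le> n" if "c \<in> set ts" for c
      using member_le_sum_list[of "num_nodes c" "map num_nodes ts"] that s by force
    with s length_le_sum_num_nodes[of ts]
    show "t \<in> PNode ` {ts. set ts \<subseteq> {t. num_nodes t \<le> n} \<and> length ts \<le> n}"
      by (auto simp: t)
  qed
  then show ?case
    using finite_lists_length_le[OF Suc] by (meson finite_imageI finite_subset)
qed

lemma finite_catalan_stanley_trees: "finite (catalan_stanley_trees n)"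
  by (rule finite_subset[OF _ finite_trees_of_bounded_size[of n]])
     (auto simp: catalan_stanley_trees_def)

lemma catalan_stanley_trees_nonempty:
  assumes "n \<ge> 1"
  shows "catalan_stanley_trees n \<noteq> {}"
proof -
  have "PNode (replicate (n - 1) (PNode [])) \<in> catalan_stanley_trees n"
    using assms by (auto simp: catalan_stanley_trees_def catalan_stanley_def sum_list_replicate)
  then show ?thesis by blast
qed

end

theory Submission
  imports Defs "HOL-Computational_Algebra.Formal_Power_Series" "HOL-Real_Asymp.Real_Asymp"
begin

text \<open>
  Let \<open>T\<close> be the generating function of plane trees, so that \<open>T (1 - T) = z\<close>. Reducing a tree \<open>r\<close> times
  cuts every branch at the node \<open>2 r\<close> steps above its rightmost leaf, and the part cut off contributes
  the factor \<open>T ^ (2 r)\<close>. Hence the first two moments of the ancestor size have generating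
  functions that are rational in \<open>T\<close>; with \<open>s = 1 - 2 T = sqrt (1 - 4 z)\<close> they are, up to easy terms,
  \<open>z\<^sup>2 T ^ (2 r) / s\<close> and \<open>z\<^sup>3 (2 T ^ (4 r) / s\<^sup>2 + 6 T ^ (2 r + 1) / s\<^sup>3) / (1 + T)\<close>.

  The coefficient of the first one, divided by the Catalan number counting all Catalan--Stanley trees, is a
  rational function of \<open>n\<close>. The second one is expanded in powers of \<open>s\<close>: the coefficients of
  \<open>s\<^sup>-\<^sup>3\<close>, \<open>s\<^sup>-\<^sup>2\<close>, \<open>s\<^sup>-\<^sup>1\<close> are explicit, and what remains lies in the algebra of power series whose
  coefficients are bounded by those of \<open>T\<close>, so it contributes \<open>O(1)\<close>. The half-integer powers of \<open>n\<close> come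
  from the quotient of \<open>4 ^ m\<close> by the central binomial coefficient, which is estimated by Wallis' product.
\<close>

section \<open>Weighted generating functions\<close>

text \<open>With a power of a parameter as the weight \<open>g\<close>, these are the moment series
  of the parameter; univariate series thus take the place of a bivariate generating function and its
  derivatives.\<close>

definition wgf :: "('a \<Rightarrow> nat) \<Rightarrow> 'a set \<Rightarrow> ('a \<Rightarrow> real) \<Rightarrow> real fps" where
  "wgf sz A g = Abs_fps (\<lambda>n. \<Sum>a | a \<in> A \<and> sz a = n. g a)"

lemma wgf_nth: "fps_nth (wgf sz A g) n = (\<Sum>a | a \<in> A \<and> sz a = n. g a)"
  by (simp add: wgf_def)

lemma wgf_add: "wgf sz A (\<lambda>a. f a + g a) = wgf sz A f + wgf sz A g"
  by (simp add: wgf_def fps_eq_iff sum.distrib)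

lemma wgf_scale: "wgf sz A (\<lambda>a. c * g a) = fps_const c * wgf sz A g"
  by (simp add: wgf_def fps_eq_iff sum_distrib_left)

lemma wgf_cong:
  assumes "\<And>a. a \<in> A \<Longrightarrow> f a = g a"
  shows "wgf sz A f = wgf sz A g"
  using assms by (auto simp: wgf_def fps_eq_iff intro!: sum.cong)

lemma wgf_bij_betw:
  assumes "bij_betw f A B" "\<And>a. a \<in> A \<Longrightarrow> sz' (f a) = sz a"
  shows "wgf sz' B g = wgf sz A (\<lambda>a. g (f a))"
proof (rule fps_ext, unfold wgf_nth)
  fix n
  have "bij_betw f {a. a \<in> A \<and> sz a = n} {b. b \<in> B \<and> sz' b = n}"
    using assms by (auto simp: bij_betw_def inj_on_def)
  then show "(\<Sum>b | b \<in> B \<and> sz' b = n. g b) = (\<Sum>a | a \<in> A \<and> sz a = n. g (f a))"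
    by (simp add: sum.reindex_bij_betw)
qed

lemma wgf_Un_disjoint:
  assumes "A \<inter> B = {}" "\<And>n. finite {a. sz a = n}"
  shows "wgf sz (A \<union> B) g = wgf sz A g + wgf sz B g"
proof (rule fps_ext)
  fix n
  have "{a. a \<in> A \<union> B \<and> sz a = n} = {a. a \<in> A \<and> sz a = n} \<union> {a. a \<in> B \<and> sz a = n}"
    by blast
  moreover have "finite {a. a \<in> A \<and> sz a = n}" "finite {a. a \<in> B \<and> sz a = n}"
    by (rule finite_subset[OF _ assms(2)[of n]]; blast)+
  ultimately show "fps_nth (wgf sz (A \<union> B) g) n = fps_nth (wgf sz A g + wgf sz B g) n"
    using assms(1) by (simp add: wgf_nth) (subst sum.union_disjoint; auto)
qed

lemma wgf_times:
  assumes "\<And>n. finite {a. sz a = n}" "\<And>n. finite {b. sz' b = n}"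
  shows "wgf (\<lambda>(a, b). sz a + sz' b) (A \<times> B) (\<lambda>(a, b). g a * h b) = wgf sz A g * wgf sz' B h"
proof (rule fps_ext)
  fix n
  \<comment> \<open>Sorting the pairs by the size \<open>i\<close> of the first component turns the
    coefficient into a Cauchy product.\<close>
  define P where "P i = {a. a \<in> A \<and> sz a = i} \<times> {b. b \<in> B \<and> sz' b = n - i}" for i
  have fin: "finite (P i)" for i
    unfolding P_def
    by (intro finite_cartesian_product finite_subset[OF _ assms(1)[of i]]
          finite_subset[OF _ assms(2)[of "n - i"]]) auto
  have "{p. p \<in> A \<times> B \<and> (case p of (a, b) \<Rightarrow> sz a + sz' b) = n} = (\<Union>i\<in>{0..n}. P i)"
    by (auto simp: P_def)
  then have "fps_nth (wgf (\<lambda>(a, b). sz a + sz' b) (A \<times> B) (\<lambda>(a, b). g a * h b)) n =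
      (\<Sum>p\<in>(\<Union>i\<in>{0..n}. P i). case p of (a, b) \<Rightarrow> g a * h b)"
    by (simp add: wgf_nth)
  also have "\<dots> = (\<Sum>i=0..n. \<Sum>p\<in>P i. case p of (a, b) \<Rightarrow> g a * h b)"
    by (rule sum.UNION_disjoint) (use fin in \<open>auto simp: P_def\<close>)
  also have "\<dots> = (\<Sum>i=0..n. fps_nth (wgf sz A g) i * fps_nth (wgf sz' B h) (n - i))"
    by (simp add: P_def wgf_nth sum_product sum.cartesian_product)
  finally show "fps_nth (wgf (\<lambda>(a, b). sz a + sz' b) (A \<times> B) (\<lambda>(a, b). g a * h b)) n =
      fps_nth (wgf sz A g * wgf sz' B h) n"
    by (simp add: fps_mult_nth)
qed

text \<open>The Euler operator \<open>z d/dz\<close>, which multiplies the coefficient of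
  \<open>z ^ n\<close> by \<open>n\<close>.\<close>

definition fps_theta :: "real fps \<Rightarrow> real fps" where
  "fps_theta f = fps_X * fps_deriv f"

lemma wgf_size: "wgf sz A (\<lambda>a. real (sz a) * g a) = fps_theta (wgf sz A g)"
proof (rule fps_ext)
  fix n
  show "fps_nth (wgf sz A (\<lambda>a. real (sz a) * g a)) n = fps_nth (fps_theta (wgf sz A g)) n"
    by (cases n) (simp_all add: fps_theta_def wgf_nth sum_distrib_left)
qed

lemma wgf_Suc: "wgf (\<lambda>a. Suc (sz a)) A g = fps_X * wgf sz A g"
proof (rule fps_ext)
  fix n
  show "fps_nth (wgf (\<lambda>a. Suc (sz a)) A g) n = fps_nth (fps_X * wgf sz A g) n"
    by (cases n) (simp_all add: wgf_nth)
qed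

text \<open>Expanding the power of \<open>x a + y b\<close> leaves sums of products, to which
  \<open>wgf_times\<close> applies. Keeping \<open>x\<close> and \<open>y\<close> apart from the
  sizes allows objects to be counted by their full size but weighted by what survives a cut.\<close>

lemma wgf_product_moments:
  fixes x :: "'a \<Rightarrow> real" and y :: "'b \<Rightarrow> real"
  assumes "\<And>n. finite {a. sz a = n}" "\<And>n. finite {b. sz' b = n}"
  defines "sz2 \<equiv> \<lambda>(a, b). sz a + sz' b"
  shows wgf_product_moment0:
      "wgf sz2 (A \<times> B) (\<lambda>_. 1) = wgf sz A (\<lambda>_. 1) * wgf sz' B (\<lambda>_. 1)"
    and wgf_product_moment1:
      "wgf sz2 (A \<times> B) (\<lambda>(a, b). x a + y b) =
         wgf sz A x * wgf sz' B (\<lambda>_. 1) + wgf sz A (\<lambda>_. 1) * wgf sz' B y"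
    and wgf_product_moment2:
      "wgf sz2 (A \<times> B) (\<lambda>(a, b). (x a + y b)\<^sup>2) =
         wgf sz A (\<lambda>a. (x a)\<^sup>2) * wgf sz' B (\<lambda>_. 1) + 2 * wgf sz A x * wgf sz' B y
         + wgf sz A (\<lambda>_. 1) * wgf sz' B (\<lambda>b. (y b)\<^sup>2)"
proof -
  note times = wgf_times[OF assms(1,2), folded sz2_def, symmetric]
  show "wgf sz2 (A \<times> B) (\<lambda>_. 1) = wgf sz A (\<lambda>_. 1) * wgf sz' B (\<lambda>_. 1)"
    unfolding times by (rule wgf_cong) auto
  show "wgf sz2 (A \<times> B) (\<lambda>(a, b). x a + y b) =
         wgf sz A x * wgf sz' B (\<lambda>_. 1) + wgf sz A (\<lambda>_. 1) * wgf sz' B y"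
    unfolding times wgf_add[symmetric] by (rule wgf_cong) auto
  have two: "2 * wgf sz A x = wgf sz A (\<lambda>a. 2 * x a)"
    by (simp add: wgf_scale numeral_fps_const)
  show "wgf sz2 (A \<times> B) (\<lambda>(a, b). (x a + y b)\<^sup>2) =
         wgf sz A (\<lambda>a. (x a)\<^sup>2) * wgf sz' B (\<lambda>_. 1) + 2 * wgf sz A x * wgf sz' B y
         + wgf sz A (\<lambda>_. 1) * wgf sz' B (\<lambda>b. (y b)\<^sup>2)"
    unfolding two times wgf_add[symmetric]
    by (rule wgf_cong) (auto simp: power2_eq_square algebra_simps)
qed

section \<open>Forests and additive parameters on them\<close>

abbreviation forest_size :: "plane_tree list \<Rightarrow> nat" where
  "forest_size ts \<equiv> sum_list (map num_nodes ts)"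

lemma finite_num_nodes_eq: "finite {t. num_nodes t = n}"
  by (rule finite_subset[OF _ finite_trees_of_bounded_size[of n]]) auto

lemma finite_forest_size_eq: "finite {ts. forest_size ts = n}"
proof -
  have "{ts. forest_size ts = n} \<subseteq> children ` {t. num_nodes t = Suc n}"
  proof
    fix ts assume "ts \<in> {ts. forest_size ts = n}"
    then show "ts \<in> children ` {t. num_nodes t = Suc n}"
      by (intro image_eqI[of _ _ "PNode ts"]) auto
  qed
  then show ?thesis using finite_num_nodes_eq finite_subset by blast
qed

text \<open>A forest is empty or a first tree followed by a forest; the empty one contributes only
  to the constant term.\<close>

lemma wgf_forest_Cons:
  "wgf forest_size (lists E) g =
     fps_const (g []) + wgf (\<lambda>(t, ts). num_nodes t + forest_size ts) (E \<times> lists E) (\<lambda>(t, ts). g (t # ts))"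
proof -
  have "ts \<in> lists E \<longleftrightarrow> ts \<in> {[]} \<union> (\<lambda>(t, ts). t # ts) ` (E \<times> lists E)" for ts
    by (cases ts) auto
  then have "lists E = {[]} \<union> (\<lambda>(t, ts). t # ts) ` (E \<times> lists E)"
    by blast
  moreover have "{[]} \<inter> (\<lambda>(t, ts). t # ts) ` (E \<times> lists E) = {}"
    by auto
  ultimately have "wgf forest_size (lists E) g =
      wgf forest_size {[]} g + wgf forest_size ((\<lambda>(t, ts). t # ts) ` (E \<times> lists E)) g"
    using wgf_Un_disjoint[OF _ finite_forest_size_eq] by metis
  also have "wgf forest_size {[]} g = fps_const (g [])"
  proof (rule fps_ext)
    fix n
    have "{a. a = [] \<and> forest_size a = n} = (if n = 0 then {[]} else {})" by auto
    then show "fps_nth (wgf forest_size {[]} g) n = fps_nth (fps_const (g [])) n"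
      by (simp add: wgf_nth)
  qed
  also have "wgf forest_size ((\<lambda>(t, ts). t # ts) ` (E \<times> lists E)) g =
     wgf (\<lambda>(t, ts). num_nodes t + forest_size ts) (E \<times> lists E) (\<lambda>p. g ((\<lambda>(t, ts). t # ts) p))"
    by (rule wgf_bij_betw) (auto simp: bij_betw_def inj_on_def)
  finally show ?thesis by (simp add: case_prod_unfold)
qed

text \<open>The decomposition at the first tree gives equations that are linear in the forest
  series, with the tree series of \<open>E\<close> as coefficient; \<open>ancestor_gf\<close> solves
  them.\<close>

lemma wgf_forest_moments:
  fixes x :: "plane_tree \<Rightarrow> real"
  defines "X \<equiv> \<lambda>ts. sum_list (map x ts)"
  shows wgf_forest_moment0: "wgf forest_size (lists E) (\<lambda>_. 1) =
      1 + wgf num_nodes E (\<lambda>_. 1) * wgf forest_size (lists E) (\<lambda>_. 1)"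
    and wgf_forest_moment1: "wgf forest_size (lists E) X =
      wgf num_nodes E x * wgf forest_size (lists E) (\<lambda>_. 1)
      + wgf num_nodes E (\<lambda>_. 1) * wgf forest_size (lists E) X"
    and wgf_forest_moment2: "wgf forest_size (lists E) (\<lambda>ts. (X ts)\<^sup>2) =
      wgf num_nodes E (\<lambda>t. (x t)\<^sup>2) * wgf forest_size (lists E) (\<lambda>_. 1)
      + 2 * wgf num_nodes E x * wgf forest_size (lists E) X
      + wgf num_nodes E (\<lambda>_. 1) * wgf forest_size (lists E) (\<lambda>ts. (X ts)\<^sup>2)"
  using wgf_forest_Cons[of E "\<lambda>_. 1"] wgf_forest_Cons[of E X] wgf_forest_Cons[of E "\<lambda>ts. (X ts)\<^sup>2"]
    wgf_product_moment0[OF finite_num_nodes_eq finite_forest_size_eq, of E "lists E"]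
    wgf_product_moment1[OF finite_num_nodes_eq finite_forest_size_eq, of E "lists E" x X]
    wgf_product_moment2[OF finite_num_nodes_eq finite_forest_size_eq, of E "lists E" x X]
  by (simp_all add: X_def case_prod_unfold)

section \<open>Moments of the ancestor size\<close>

definition tree_gf :: "real fps" where
  "tree_gf = wgf num_nodes UNIV (\<lambda>_. 1)"

lemma bij_PNode_lists: "bij_betw PNode (lists E) {t. \<forall>c\<in>set (children t). c \<in> E}"
  by (rule bij_betw_byWitness[where f' = children]) auto

lemma wgf_PNode:
  "wgf num_nodes {t. \<forall>c\<in>set (children t). c \<in> E} g = fps_X * wgf forest_size (lists E) (\<lambda>ts. g (PNode ts))"
  unfolding wgf_Suc[symmetric] by (rule wgf_bij_betw[OF bij_PNode_lists]) auto

text \<open>A node of a rightmost path together with the branches to the left of the path is again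
  an arbitrary plane tree, so each such node will contribute a factor \<open>T\<close>.\<close>

lemma wgf_root_forest: "wgf (\<lambda>ts. Suc (forest_size ts)) UNIV (\<lambda>_. 1) = tree_gf"
  using wgf_PNode[of UNIV "\<lambda>_. 1"] by (simp add: tree_gf_def wgf_Suc)

text \<open>Forests have the series \<open>F = 1 / (1 - T)\<close>, and a root on top of a forest
  gives \<open>T = z F\<close>.\<close>

lemma tree_gf_eq: "tree_gf * (1 - tree_gf) = fps_X"
proof -
  define F where "F = wgf forest_size UNIV (\<lambda>_. 1)"
  have "F = 1 + tree_gf * F"
    using wgf_forest_moment0[of UNIV] by (simp add: F_def tree_gf_def)
  moreover have "tree_gf = fps_X * F"
    using wgf_root_forest by (simp add: wgf_Suc F_def)
  ultimately show ?thesis by algebra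
qed

declare rightmost_depth.simps [simp del]

lemma rightmost_depth_Nil [simp]: "rightmost_depth (PNode []) = 0"
  by (simp add: rightmost_depth.simps)

lemma rightmost_depth_snoc [simp]: "rightmost_depth (PNode (ts @ [c])) = Suc (rightmost_depth c)"
  by (simp add: rightmost_depth.simps)

section \<open>Branches by rightmost depth, and their size after a cut\<close>

definition trees_of_depth :: "nat set \<Rightarrow> plane_tree set" where
  "trees_of_depth K = {c. rightmost_depth c \<in> K}"

definition cut_size :: "nat \<Rightarrow> plane_tree \<Rightarrow> real" where
  "cut_size i c = real (num_nodes (cut_rightmost (rightmost_depth c - i) c))"

text \<open>Peels the top node off the rightmost path: this separates the branches left of the path
  from the last child, whose depth is smaller by one.\<close>

lemma bij_snoc_trees_of_depth:
  "bij_betw (\<lambda>(ts, c). PNode (ts @ [c])) (UNIV \<times> trees_of_depth K) (trees_of_depth (Suc ` K))"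
proof (rule bij_betw_byWitness[where f' = "\<lambda>t. (butlast (children t), last (children t))"])
  have *: "children t \<noteq> []" if "t \<in> trees_of_depth (Suc ` K)" for t
    using that by (cases t) (auto simp: trees_of_depth_def)
  show "\<forall>t\<in>trees_of_depth (Suc ` K). (\<lambda>(ts, c). PNode (ts @ [c])) (butlast (children t), last (children t)) = t"
    using * by simp
  show "(\<lambda>t. (butlast (children t), last (children t))) ` trees_of_depth (Suc ` K) \<subseteq> UNIV \<times> trees_of_depth K"
  proof clarsimp
    fix t assume t: "t \<in> trees_of_depth (Suc ` K)"
    then have "rightmost_depth (PNode (butlast (children t) @ [last (children t)])) \<in> Suc ` K"
      using *[OF t] by (simp add: trees_of_depth_def)
    then show "last (children t) \<in> trees_of_depth K"
      unfolding rightmost_depth_snoc by (auto simp: trees_of_depth_def)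
  qed
qed (auto simp: trees_of_depth_def)

lemma wgf_snoc:
  "wgf num_nodes (trees_of_depth (Suc ` K)) g =
     wgf (\<lambda>(ts, c). Suc (forest_size ts) + num_nodes c) (UNIV \<times> trees_of_depth K)
       (\<lambda>(ts, c). g (PNode (ts @ [c])))"
  by (subst wgf_bij_betw[OF bij_snoc_trees_of_depth]) (auto simp: case_prod_unfold)

lemma cut_size_snoc:
  assumes "i \<le> rightmost_depth c"
  shows "cut_size i (PNode (ts @ [c])) = real (Suc (forest_size ts)) + cut_size i c"
  using assms by (simp add: cut_size_def Suc_diff_le)

lemma finite_Suc_forest_size_eq: "finite {ts. Suc (forest_size ts) = n}"
  by (cases n) (use finite_forest_size_eq in simp_all)

lemma wgf_root_forest_size:
  "wgf (\<lambda>ts. Suc (forest_size ts)) UNIV (\<lambda>ts. real (Suc (forest_size ts))) = fps_theta tree_gf"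
  using wgf_size[of "\<lambda>ts. Suc (forest_size ts)" UNIV "\<lambda>_. 1"] by (simp add: wgf_root_forest)

lemma wgf_root_forest_size2:
  "wgf (\<lambda>ts. Suc (forest_size ts)) UNIV (\<lambda>ts. (real (Suc (forest_size ts)))\<^sup>2) = fps_theta (fps_theta tree_gf)"
  using wgf_size[of "\<lambda>ts. Suc (forest_size ts)" UNIV "\<lambda>ts. real (Suc (forest_size ts))"]
  unfolding wgf_root_forest_size power2_eq_square .

text \<open>A new top node lengthens the rightmost path by one and lies above the cut, because
  \<open>i \<le> k\<close>. Its whole left part is therefore added to the cut size, and the moments
  are those of a sum on pairs.\<close>

lemma cut_moments_Suc:
  fixes i :: nat
  assumes "\<And>k. k \<in> K \<Longrightarrow> i \<le> k"
  defines "M \<equiv> \<lambda>K p. wgf num_nodes (trees_of_depth K) (\<lambda>c. cut_size i c ^ p)"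
  shows "M (Suc ` K) 0 = tree_gf * M K 0"
    and "M (Suc ` K) 1 = fps_theta tree_gf * M K 0 + tree_gf * M K 1"
    and "M (Suc ` K) 2 = fps_theta (fps_theta tree_gf) * M K 0 + 2 * fps_theta tree_gf * M K 1 + tree_gf * M K 2"
proof -
  have M: "M (Suc ` K) p = wgf (\<lambda>(ts, c). Suc (forest_size ts) + num_nodes c) (UNIV \<times> trees_of_depth K)
       (\<lambda>(ts, c). (real (Suc (forest_size ts)) + cut_size i c) ^ p)" for p
    unfolding M_def wgf_snoc
    by (rule wgf_cong) (use assms(1) in \<open>auto simp: trees_of_depth_def cut_size_snoc\<close>)
  note mom = wgf_product_moments[OF finite_Suc_forest_size_eq finite_num_nodes_eq]
  show "M (Suc ` K) 0 = tree_gf * M K 0"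
    unfolding M using mom(1) by (simp add: M_def wgf_root_forest case_prod_unfold)
  show "M (Suc ` K) 1 = fps_theta tree_gf * M K 0 + tree_gf * M K 1"
    unfolding M power_one_right mom(2) wgf_root_forest wgf_root_forest_size by (simp add: M_def)
  show "M (Suc ` K) 2 = fps_theta (fps_theta tree_gf) * M K 0 + 2 * fps_theta tree_gf * M K 1 + tree_gf * M K 2"
    unfolding M mom(3) wgf_root_forest wgf_root_forest_size wgf_root_forest_size2 by (simp add: M_def)
qed

text \<open>The leaf at the end of the path contributes \<open>z\<close>, and each of the
  \<open>i\<close> path nodes above it contributes \<open>T\<close>.\<close>

lemma wgf_depth_eq: "wgf num_nodes (trees_of_depth {i}) (\<lambda>_. 1) = fps_X * tree_gf ^ i"
proof (induction i)
  case 0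
  have leaf: "rightmost_depth t = 0 \<longleftrightarrow> t = PNode []" for t
    by (cases t) (simp add: rightmost_depth.simps)
  show ?case
  proof (rule fps_ext)
    fix n :: nat
    have "{a. a \<in> trees_of_depth {0} \<and> num_nodes a = n} = (if n = 1 then {PNode []} else {})"
      by (auto simp: trees_of_depth_def leaf)
    then show "fps_nth (wgf num_nodes (trees_of_depth {0}) (\<lambda>_. 1)) n = fps_nth (fps_X * tree_gf ^ 0) n"
      by (simp add: wgf_nth)
  qed
next
  case (Suc i)
  then show ?case using cut_moments_Suc(1)[of "{i}" 0] by simp
qed

text \<open>For \<open>i = 2 * r\<close> these are the depths of the branches of a Catalan--Stanley
  tree that survive \<open>r\<close> reductions.\<close>

definition depths_above :: "nat \<Rightarrow> nat set" where
  "depths_above i = {k. i \<le> k \<and> even (k - i)}"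

definition cut_moment :: "nat \<Rightarrow> nat \<Rightarrow> real fps" where
  "cut_moment i p = wgf num_nodes (trees_of_depth (depths_above i)) (\<lambda>c. cut_size i c ^ p)"

lemma depths_above_unfold: "depths_above i = {i} \<union> Suc ` Suc ` depths_above i"
proof -
  have "k \<in> {i} \<union> Suc ` Suc ` depths_above i" if "k \<in> depths_above i" for k
  proof (cases "k = i")
    case False
    obtain j where "k - i = 2 * j" "i \<le> k"
      using \<open>k \<in> depths_above i\<close> unfolding depths_above_def by (blast elim: evenE)
    with False have "k = Suc (Suc (i + 2 * (j - 1)))" by (cases j) auto
    moreover have "i + 2 * (j - 1) \<in> depths_above i" by (simp add: depths_above_def)
    ultimately show ?thesis by blast
  qed simp
  moreover have "Suc (Suc k) \<in> depths_above i" if "k \<in> depths_above i" for k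
    using that by (auto simp: depths_above_def Suc_diff_le)
  moreover have "i \<in> depths_above i" by (simp add: depths_above_def)
  ultimately show ?thesis by blast
qed

text \<open>At depth exactly \<open>i\<close> the cut leaves a single node, so all moments of these
  branches equal \<open>z T ^ i\<close>. Every other admissible depth is two more than an admissible
  one, so \<open>cut_moments_Suc\<close> applies twice.\<close>

lemma cut_moment_eqs:
  fixes i :: nat
  defines "T \<equiv> tree_gf" and "T1 \<equiv> fps_theta tree_gf" and "T2 \<equiv> fps_theta (fps_theta tree_gf)"
    and "M \<equiv> cut_moment i"
  shows "M 0 = fps_X * T ^ i + T * (T * M 0)"
    and "M 1 = fps_X * T ^ i + T1 * (T * M 0) + T * (T1 * M 0 + T * M 1)"
    and "M 2 = fps_X * T ^ i + T2 * (T * M 0) + 2 * T1 * (T1 * M 0 + T * M 1)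
           + T * (T2 * M 0 + 2 * T1 * M 1 + T * M 2)"
proof -
  define D where "D = depths_above i"
  have ge: "k \<in> D \<Longrightarrow> i \<le> k" for k by (simp add: D_def depths_above_def)
  have ge': "k \<in> Suc ` D \<Longrightarrow> i \<le> k" for k using ge by fastforce
  have split: "M p = fps_X * T ^ i + wgf num_nodes (trees_of_depth (Suc ` Suc ` D)) (\<lambda>c. cut_size i c ^ p)" for p
  proof -
    have "trees_of_depth D = trees_of_depth {i} \<union> trees_of_depth (Suc ` Suc ` D)"
      unfolding D_def by (subst depths_above_unfold) (auto simp: trees_of_depth_def)
    moreover have "trees_of_depth {i} \<inter> trees_of_depth (Suc ` Suc ` D) = {}"
      using ge by (fastforce simp: trees_of_depth_def)
    moreover have "wgf num_nodes (trees_of_depth {i}) (\<lambda>c. cut_size i c ^ p) = fps_X * T ^ i"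
      unfolding T_def wgf_depth_eq[symmetric]
      by (rule wgf_cong) (auto simp: trees_of_depth_def cut_size_def)
    ultimately show ?thesis
      by (simp add: M_def cut_moment_def D_def[symmetric] wgf_Un_disjoint finite_num_nodes_eq)
  qed
  note steps = cut_moments_Suc[of D i, OF ge, folded cut_moment_def[of i, folded D_def] M_def T_def T1_def T2_def]
  note steps' = cut_moments_Suc[of "Suc ` D" i, OF ge', folded T_def T1_def T2_def]
  show "M 0 = fps_X * T ^ i + T * (T * M 0)"
    by (rule trans[OF split]) (simp only: steps' steps)
  show "M 1 = fps_X * T ^ i + T1 * (T * M 0) + T * (T1 * M 0 + T * M 1)"
    by (rule trans[OF split]) (simp only: steps' steps add.assoc)
  show "M 2 = fps_X * T ^ i + T2 * (T * M 0) + 2 * T1 * (T1 * M 0 + T * M 1)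
           + T * (T2 * M 0 + 2 * T1 * M 1 + T * M 2)"
    by (rule trans[OF split]) (simp only: steps' steps add.assoc)
qed

lemma cut_rightmost_depth: "cut_rightmost (rightmost_depth t) t = t"
proof (induction "rightmost_depth t" arbitrary: t)
  case 0
  then show ?case by (cases t) (simp add: rightmost_depth.simps split: if_splits)
next
  case (Suc d)
  then obtain ts where ts: "t = PNode ts" "ts \<noteq> []"
    by (cases t) (auto simp: rightmost_depth.simps split: if_splits)
  then have "t = PNode (butlast ts @ [last ts])" by simp
  with Suc show ?case by (metis append_butlast_last_id cut_rightmost.simps(2) nat.inject rightmost_depth_snoc ts)
qed

lemma cut_rightmost_cut:
  "j \<le> k \<Longrightarrow> cut_rightmost j (cut_rightmost k t) = cut_rightmost j t"
proof (induction k t arbitrary: j rule: cut_rightmost.induct)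
  case (2 k ts)
  then show ?case by (cases j) auto
qed simp

lemma tree_gf_nth_0: "fps_nth tree_gf 0 = 0"
  by (simp add: tree_gf_def wgf_nth num_nodes_pos[THEN less_imp_neq, symmetric] del: not_gr_zero)

lemma one_minus_tree_gf_nonzero: "1 - tree_gf \<noteq> 0" "1 - tree_gf\<^sup>2 \<noteq> 0"
  by (auto simp: fps_eq_iff tree_gf_nth_0 power2_eq_square intro!: exI[of _ 0])

text \<open>For \<open>i = 0\<close> nothing is cut, so the cut size is the size itself and its
  moments come from the Euler operator.\<close>

lemma cut_moment_0:
  "cut_moment 0 0 = wgf num_nodes {c. even (rightmost_depth c)} (\<lambda>_. 1)"
  "cut_moment 0 1 = fps_theta (cut_moment 0 0)"
  "cut_moment 0 2 = fps_theta (fps_theta (cut_moment 0 0))"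
proof -
  have size: "cut_size 0 c = real (num_nodes c)" for c
    by (simp add: cut_size_def cut_rightmost_depth)
  show "cut_moment 0 0 = wgf num_nodes {c. even (rightmost_depth c)} (\<lambda>_. 1)"
    by (simp add: cut_moment_def trees_of_depth_def depths_above_def)
  show 1: "cut_moment 0 1 = fps_theta (cut_moment 0 0)"
    using wgf_size[of num_nodes _ "\<lambda>_. 1"] by (simp add: cut_moment_def size)
  show "cut_moment 0 2 = fps_theta (fps_theta (cut_moment 0 0))"
    using wgf_size[of num_nodes _ "\<lambda>c. real (num_nodes c)"] unfolding 1[symmetric]
    by (simp add: cut_moment_def size power2_eq_square)
qed

text \<open>Both sides solve the linear system of \<open>cut_moment_eqs\<close>, whose matrix has the unit \<open>1 - T\<^sup>2\<close> on its diagonal.\<close>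
lemma cut_moment_shift:
  assumes "p \<le> 2"
  shows "cut_moment i p = tree_gf ^ i * cut_moment 0 p"
proof -
  define P where "P = tree_gf ^ i"
  note eqs = cut_moment_eqs[of i, folded P_def] cut_moment_eqs[of 0, unfolded power_0]
  have cancel: "a = b" if "(1 - tree_gf\<^sup>2) * a = (1 - tree_gf\<^sup>2) * b" for a b
    using that one_minus_tree_gf_nonzero(2) by simp
  have 0: "cut_moment i 0 = P * cut_moment 0 0"
    by (rule cancel) (use eqs(1,4) in algebra)
  have 1: "cut_moment i 1 = P * cut_moment 0 1"
    by (rule cancel) (use eqs(2,5) 0 in algebra)
  have 2: "cut_moment i 2 = P * cut_moment 0 2"
    by (rule cancel) (use eqs(3,6) 0 1 in algebra)
  have "p = 0 \<or> p = 1 \<or> p = 2" using assms by auto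
  with 0 1 2 show ?thesis unfolding P_def by metis
qed

section \<open>Calculus of the series \<open>T\<close>, \<open>w\<close> and
  \<open>h\<close>\<close>

text \<open>\<open>w = 1 / s = 1 / sqrt (1 - 4 z)\<close> and \<open>h = 1 / (1 + T)\<close>.\<close>
definition tree_w :: "real fps" where "tree_w = inverse (1 - 2 * tree_gf)"
definition tree_h :: "real fps" where "tree_h = inverse (1 + tree_gf)"

lemma tree_w: "(1 - 2 * tree_gf) * tree_w = 1"
  unfolding tree_w_def by (subst mult.commute, rule inverse_mult_eq_1) (simp add: tree_gf_nth_0)

lemma tree_h: "(1 + tree_gf) * tree_h = 1"
  unfolding tree_h_def by (subst mult.commute, rule inverse_mult_eq_1) (simp add: tree_gf_nth_0)

text \<open>Differentiating \<open>T (1 - T) = z\<close>. With the two lemmas that follow,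
  derivatives of polynomials in \<open>z\<close>, \<open>T\<close>, \<open>w\<close>,
  \<open>h\<close> are again such polynomials.\<close>

lemma deriv_tree_gf: "fps_deriv tree_gf = tree_w"
proof -
  have "fps_deriv (tree_gf * (1 - tree_gf)) = 1"
    by (simp add: tree_gf_eq)
  then have "(1 - 2 * tree_gf) * fps_deriv tree_gf = 1"
    by (simp add: algebra_simps)
  then show ?thesis using tree_w by algebra
qed

lemma deriv_tree_w: "fps_deriv tree_w = 2 * tree_w ^ 3"
proof -
  have "fps_deriv ((1 - 2 * tree_gf) * tree_w) = 0"
    unfolding tree_w by simp
  then have "(1 - 2 * tree_gf) * fps_deriv tree_w - 2 * tree_w * tree_w = 0"
    by (simp add: deriv_tree_gf algebra_simps fps_deriv_mult)
  then show ?thesis using tree_w by algebra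
qed

lemma deriv_tree_h: "fps_deriv tree_h = - (tree_w * tree_h\<^sup>2)"
proof -
  have "fps_deriv ((1 + tree_gf) * tree_h) = 0"
    unfolding tree_h by simp
  then have "(1 + tree_gf) * fps_deriv tree_h + tree_w * tree_h = 0"
    by (simp add: deriv_tree_gf algebra_simps)
  then show ?thesis using tree_h by algebra
qed

text \<open>The zeroth moment is \<open>z / (1 - T ^ 2)\<close>, and \<open>z = T (1 - T)\<close>
  turns it into \<open>T / (1 + T)\<close>.\<close>

lemma cut_moment_0_0: "cut_moment 0 0 = 1 - tree_h"
proof -
  have "(1 - tree_gf) * ((1 + tree_gf) * cut_moment 0 0) = (1 - tree_gf) * tree_gf"
    using cut_moment_eqs(1)[of 0] tree_gf_eq by algebra
  then have "(1 + tree_gf) * cut_moment 0 0 = tree_gf"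
    using one_minus_tree_gf_nonzero(1) by simp
  then have "tree_h * ((1 + tree_gf) * cut_moment 0 0) = (1 + tree_gf) * tree_h - tree_h"
    by (simp add: algebra_simps)
  moreover have "tree_h * ((1 + tree_gf) * cut_moment 0 0) = ((1 + tree_gf) * tree_h) * cut_moment 0 0"
    by (simp only: mult_ac)
  ultimately show ?thesis by (simp add: tree_h)
qed

lemma cut_moment_0_1: "cut_moment 0 1 = fps_X * tree_w * tree_h\<^sup>2"
  unfolding cut_moment_0(2) by (simp add: cut_moment_0_0 fps_theta_def deriv_tree_h algebra_simps)

lemma cut_moment_0_2:
  "cut_moment 0 2 = fps_X * tree_w * tree_h\<^sup>2 + 6 * fps_X\<^sup>2 * tree_gf * tree_w ^ 3 * tree_h ^ 3"
proof -
  have theta: "cut_moment 0 2 = fps_theta (fps_X * tree_w * tree_h\<^sup>2)"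
    by (simp only: cut_moment_0(2,3) flip: cut_moment_0_1)
  have "fps_deriv (fps_X * tree_w * tree_h\<^sup>2) =
      tree_w * tree_h\<^sup>2 + fps_X * (2 * tree_w ^ 3 * tree_h\<^sup>2 - 2 * tree_w\<^sup>2 * tree_h ^ 3)"
    by (simp add: deriv_tree_w deriv_tree_h power2_eq_square power3_eq_cube algebra_simps)
  \<comment> \<open>Taking out \<open>2 w ^ 3 h ^ 3\<close> leaves
    \<open>(1 + T) - (1 - 2 T) = 3 T\<close>.\<close>
  also have "2 * tree_w ^ 3 * tree_h\<^sup>2 - 2 * tree_w\<^sup>2 * tree_h ^ 3 = 6 * tree_gf * tree_w ^ 3 * tree_h ^ 3"
    using tree_w tree_h by algebra
  finally show ?thesis
    unfolding theta fps_theta_def by algebra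
qed

section \<open>Iterated reduction and the moments for whole trees\<close>

definition branch_size :: "nat \<Rightarrow> plane_tree \<Rightarrow> real" where
  "branch_size r c = (if rightmost_depth c < 2 * r then 0 else cut_size (2 * r) c)"

text \<open>A branch of depth below \<open>2 * r\<close> has vanished after \<open>r\<close>
  reductions and weighs \<open>0 ^ p\<close>, which is \<open>0\<close> because
  \<open>p > 0\<close>; the remaining even depths are exactly
  \<open>depths_above (2 * r)\<close>.\<close>

lemma wgf_branch_size:
  assumes "p > 0"
  shows "wgf num_nodes {c. even (rightmost_depth c)} (\<lambda>c. branch_size r c ^ p) = cut_moment (2 * r) p"
proof (rule fps_ext)
  fix n
  show "fps_nth (wgf num_nodes {c. even (rightmost_depth c)} (\<lambda>c. branch_size r c ^ p)) n =
     fps_nth (cut_moment (2 * r) p) n"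
    unfolding cut_moment_def wgf_nth
    by (rule sum.mono_neutral_cong_right)
       (use assms finite_num_nodes_eq[of n] in
         \<open>auto simp: trees_of_depth_def depths_above_def branch_size_def intro: finite_subset[rotated]\<close>)
qed

text \<open>Each reduction moves the cut two steps further up the rightmost path, and the higher cut
  absorbs the lower one. Hence \<open>r\<close> reductions amount to one cut \<open>2 * r\<close>
  steps above the leaf, and branches too short for it have vanished.\<close>

lemma ancestor_eq:
  assumes "catalan_stanley t"
  shows "(reduction ^^ r) t = PNode (map (\<lambda>c. cut_rightmost (rightmost_depth c - 2 * r) c)
           (filter (\<lambda>c. 2 * r \<le> rightmost_depth c) (children t)))"
proof (induction r)
  case 0
  show ?case by (cases t) (simp add: cut_rightmost_depth)
next
  case (Suc r)
  have even: "even (rightmost_depth c)" if "c \<in> set (children t)" for c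
    using assms that by (auto simp: catalan_stanley_def)
  have red: "reduction (PNode xs) = PNode (map (\<lambda>c. cut_rightmost (rightmost_depth c - 2) c)
      (filter (\<lambda>c. rightmost_depth c \<noteq> 0) xs))" for xs
    by (simp only: reduction_def plane_tree.sel)
  define cs where "cs = children t"
  have "\<forall>c\<in>set cs. even (rightmost_depth c)" using even by (simp add: cs_def)
  then have "map (\<lambda>c. cut_rightmost (rightmost_depth c - 2) c) (filter (\<lambda>c. rightmost_depth c \<noteq> 0)
        (map (\<lambda>c. cut_rightmost (rightmost_depth c - 2 * r) c) (filter (\<lambda>c. 2 * r \<le> rightmost_depth c) cs)))
      = map (\<lambda>c. cut_rightmost (rightmost_depth c - 2 * Suc r) c) (filter (\<lambda>c. 2 * Suc r \<le> rightmost_depth c) cs)"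
  proof (induction cs)
    case (Cons c cs)
    obtain d where d: "rightmost_depth c = 2 * d" using Cons.prems by (auto elim: evenE)
    have "\<forall>c\<in>set cs. even (rightmost_depth c)" using Cons.prems by simp
    note IH = Cons.IH[OF this]
    \<comment> \<open>The branch is already gone, or it is a single leaf that is deleted now, or it
      is cut once more.\<close>
    consider "d < r" | "d = r" | "Suc r \<le> d" by linarith
    then show ?case
      by cases (use IH in \<open>simp_all add: d rightmost_depth_cut cut_rightmost_cut\<close>)
  qed simp
  moreover have "(reduction ^^ Suc r) t = reduction (PNode (map (\<lambda>c. cut_rightmost (rightmost_depth c - 2 * r) c)
           (filter (\<lambda>c. 2 * r \<le> rightmost_depth c) cs)))"
    by (simp add: Suc cs_def)
  ultimately show ?case
    by (simp only: red cs_def)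
qed

lemma ancestor_size_PNode:
  assumes "cs \<in> lists {c. even (rightmost_depth c)}"
  shows "ancestor_size r (PNode cs) = 1 + sum_list (map (branch_size r) cs)"
proof -
  have "catalan_stanley (PNode cs)" using assms by (auto simp: catalan_stanley_def)
  moreover have "real (forest_size (map (\<lambda>c. cut_rightmost (rightmost_depth c - 2 * r) c)
      (filter (\<lambda>c. 2 * r \<le> rightmost_depth c) cs))) = sum_list (map (branch_size r) cs)"
    by (induction cs) (auto simp: branch_size_def cut_size_def)
  ultimately show ?thesis by (simp add: ancestor_size_def ancestor_eq)
qed

text \<open>A tree is a root over a forest of branches of even depth, and its ancestor size is
  \<open>1\<close> plus an additive parameter of that forest. The branch series is
  \<open>1 - h\<close>, so every forest equation has the form \<open>a = c + (1 - h) a\<close>, with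
  solution \<open>(1 + T) c\<close>.\<close>

lemma ancestor_gf:
  fixes r :: nat
  defines "P \<equiv> tree_gf ^ (2 * r)" and "G \<equiv> wgf num_nodes {t. catalan_stanley t}"
  shows "G (\<lambda>_. 1) = fps_X * (1 + tree_gf)"
    and "G (ancestor_size r) = G (\<lambda>_. 1) + fps_X\<^sup>2 * (P * tree_w)"
    and "G (\<lambda>t. (ancestor_size r t)\<^sup>2) = G (\<lambda>_. 1) + fps_X\<^sup>2 * (3 * (P * tree_w)
      + (2 * P\<^sup>2 * fps_X * tree_h * tree_w\<^sup>2 + 6 * P * tree_gf * fps_X * tree_h * tree_w ^ 3))"
proof -
  define E where "E = {c. even (rightmost_depth c)}"
  define x where "x = branch_size r"
  define X where "X = (\<lambda>ts. sum_list (map x ts))"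
  define L where "L = wgf forest_size (lists E)"
  define L0 where "L0 = L (\<lambda>_. 1)"
  define L1 where "L1 = L X"
  define L2 where "L2 = L (\<lambda>ts. (X ts)\<^sup>2)"
  note L2_sum = L2_def[unfolded X_def]
  define B1 where "B1 = P * (fps_X * tree_w * tree_h\<^sup>2)"
  define B2 where "B2 = P * (fps_X * tree_w * tree_h\<^sup>2 + 6 * fps_X\<^sup>2 * tree_gf * tree_w ^ 3 * tree_h ^ 3)"
  have B: "wgf num_nodes E (\<lambda>_. 1) = 1 - tree_h" "wgf num_nodes E x = B1"
      "wgf num_nodes E (\<lambda>c. (x c)\<^sup>2) = B2"
    using wgf_branch_size[of 1 r] wgf_branch_size[of 2 r] cut_moment_shift[of 1 "2 * r"] cut_moment_shift[of 2 "2 * r"]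
    unfolding cut_moment_0_1 cut_moment_0_2
    by (simp_all add: E_def x_def B1_def B2_def cut_moment_0_0 P_def flip: cut_moment_0(1))
  note mom = wgf_forest_moment0[of E] wgf_forest_moment1[of E x] wgf_forest_moment2[of E x]
  note mom = mom[folded X_def, folded L_def, folded L0_def L1_def L2_sum, unfolded B]
  have solve: "a = (1 + tree_gf) * c" if "a = c + (1 - tree_h) * a" for a c
  proof -
    have "tree_h * a = c" using that by (simp add: algebra_simps)
    then show ?thesis using tree_h by (metis mult.assoc mult_1)
  qed
  have L0: "L0 = 1 + tree_gf"
    using solve[OF mom(1)] by simp
  have "L1 = (1 + tree_gf) * (B1 * L0)"
    by (rule solve[OF mom(2)])
  also have "\<dots> = ((1 + tree_gf) * tree_h)\<^sup>2 * (fps_X * (P * tree_w))"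
    unfolding L0 B1_def by (simp add: power2_eq_square mult_ac)
  finally have L1: "L1 = fps_X * (P * tree_w)"
    unfolding tree_h by simp
  have "L2 = (1 + tree_gf) * (B2 * L0 + 2 * B1 * L1)"
    by (rule solve[OF mom(3)])
  also have "\<dots> = ((1 + tree_gf) * tree_h)\<^sup>2 *
        (fps_X * (P * tree_w) + 6 * P * tree_gf * fps_X\<^sup>2 * tree_h * tree_w ^ 3)
      + ((1 + tree_gf) * tree_h) * (2 * P\<^sup>2 * fps_X\<^sup>2 * tree_h * tree_w\<^sup>2)"
    unfolding L0 L1 B1_def B2_def by algebra
  finally have L2: "L2 = fps_X * (P * tree_w) + fps_X * (2 * P\<^sup>2 * fps_X * tree_h * tree_w\<^sup>2
       + 6 * P * tree_gf * fps_X * tree_h * tree_w ^ 3)"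
    unfolding tree_h by (simp add: power2_eq_square algebra_simps)
  have cs: "{t. catalan_stanley t} = {t. \<forall>c\<in>set (children t). c \<in> E}"
    by (auto simp: catalan_stanley_def E_def)
  have G: "G g = fps_X * L (\<lambda>ts. g (PNode ts))" for g
    unfolding G_def cs wgf_PNode L_def by simp
  show 0: "G (\<lambda>_. 1) = fps_X * (1 + tree_gf)"
    unfolding G L0[symmetric] L0_def ..
  have "L (\<lambda>ts. ancestor_size r (PNode ts)) = L (\<lambda>ts. 1 + X ts)"
    unfolding L_def by (rule wgf_cong) (simp add: ancestor_size_PNode E_def X_def x_def)
  also have "\<dots> = L0 + L1" by (simp add: L_def wgf_add L0_def L1_def)
  finally show "G (ancestor_size r) = G (\<lambda>_. 1) + fps_X\<^sup>2 * (P * tree_w)"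
    unfolding 0 G L0 L1 by (simp add: power2_eq_square algebra_simps)
  \<comment> \<open>The square of \<open>1 + X\<close> supplies two copies of the first moment and
    \<open>L2\<close> a third one; this is the factor 3 in the result.\<close>
  have "L (\<lambda>ts. (ancestor_size r (PNode ts))\<^sup>2) = L (\<lambda>ts. 1 + (2 * X ts + (X ts)\<^sup>2))"
    unfolding L_def
    by (rule wgf_cong) (simp add: ancestor_size_PNode E_def X_def x_def power2_eq_square algebra_simps)
  also have "\<dots> = L0 + (2 * L1 + L2)"
    unfolding L_def wgf_add wgf_scale by (simp add: L_def L0_def L1_def L2_def numeral_fps_const)
  finally show "G (\<lambda>t. (ancestor_size r t)\<^sup>2) = G (\<lambda>_. 1) + fps_X\<^sup>2 * (3 * (P * tree_w)
      + (2 * P\<^sup>2 * fps_X * tree_h * tree_w\<^sup>2 + 6 * P * tree_gf * fps_X * tree_h * tree_w ^ 3))"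
    unfolding 0 G L0 L1 L2 by (simp add: power2_eq_square algebra_simps)
qed

section \<open>Expansion at the dominant singularity\<close>

lemma tree_s_square: "(1 - 2 * tree_gf)\<^sup>2 = 1 - 4 * fps_X"
  unfolding tree_gf_eq[symmetric] by (simp add: power2_eq_square algebra_simps)

lemma tree_w_nth_0: "fps_nth tree_w 0 = 1"
  using arg_cong[OF tree_w, of "\<lambda>f. fps_nth f 0"] by (simp add: tree_gf_nth_0)

lemma tree_w_square: "(1 - 4 * fps_X) * tree_w\<^sup>2 = 1"
  unfolding tree_s_square[symmetric] power_mult_distrib[symmetric] tree_w by simp

text \<open>The differential equation \<open>(1 - 4 z) w' = 2 w\<close> in coefficients. Since
  \<open>w\<close> has constant term 1, its coefficients are the central binomial
  coefficients.\<close>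

lemma tree_w_Suc: "real (m + 1) * fps_nth tree_w (m + 1) = (4 * real m + 2) * fps_nth tree_w m"
proof -
  have "(1 - 4 * fps_X) * fps_deriv tree_w = 2 * (((1 - 4 * fps_X) * tree_w\<^sup>2) * tree_w)"
    by (simp add: deriv_tree_w power2_eq_square power3_eq_cube mult_ac)
  then have "fps_deriv tree_w - fps_const 4 * (fps_X * fps_deriv tree_w) = fps_const 2 * tree_w"
    unfolding tree_w_square by (simp add: algebra_simps numeral_fps_const)
  from arg_cong[OF this, of "\<lambda>f. fps_nth f m"] show ?thesis
    by (cases m) (simp_all add: algebra_simps)
qed

lemma tree_w_pos: "fps_nth tree_w m > 0"
proof (induction m)
  case (Suc m)
  then have "real (m + 1) * fps_nth tree_w (m + 1) > 0"
    unfolding tree_w_Suc by simp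
  then show ?case by (simp add: zero_less_mult_iff)
qed (simp add: tree_w_nth_0)

text \<open>From \<open>T' = w\<close>; these are the Catalan numbers.\<close>

lemma tree_gf_nth_Suc: "fps_nth tree_gf (Suc m) = fps_nth tree_w m / real (m + 1)"
  using arg_cong[OF deriv_tree_gf, of "\<lambda>f. fps_nth f m"] by (simp add: field_simps)

lemma tree_w_square_nth: "fps_nth (tree_w\<^sup>2) m = 4 ^ m"
proof (induction m)
  case 0
  then show ?case by (simp add: tree_w_nth_0 power2_eq_square)
next
  case (Suc m)
  have "tree_w\<^sup>2 - fps_const 4 * (fps_X * tree_w\<^sup>2) = 1"
    using tree_w_square by (simp add: algebra_simps numeral_fps_const)
  from arg_cong[OF this, of "\<lambda>f. fps_nth f (Suc m)"] Suc show ?case by simp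
qed

text \<open>From \<open>w' = 2 w ^ 3\<close> and the recursion for the coefficients of
  \<open>w\<close>.\<close>

lemma tree_w_cube_nth: "fps_nth (tree_w ^ 3) m = (2 * real m + 1) * fps_nth tree_w m"
proof -
  have "fps_deriv tree_w = fps_const 2 * tree_w ^ 3"
    by (simp add: deriv_tree_w numeral_fps_const)
  from arg_cong[OF this, of "\<lambda>f. fps_nth f m"] tree_w_Suc[of m] show ?thesis
    by (simp add: algebra_simps)
qed

text \<open>Compare coefficients in \<open>z (T ^ k)' = k T ^ k (1 - T) w\<close> and \<open>T ^ k = T ^ k (1 - 2 T) w\<close>.\<close>
lemma tree_gf_power_w_Suc:
  "(2 * real m - real k) * fps_nth (tree_gf ^ Suc k * tree_w) m =
     (real m - real k) * fps_nth (tree_gf ^ k * tree_w) m"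
proof -
  define c d where "c = fps_nth (tree_gf ^ k * tree_w) m" and "d = fps_nth (tree_gf ^ Suc k * tree_w) m"
  have "tree_gf ^ k = tree_gf ^ k * ((1 - 2 * tree_gf) * tree_w)"
    unfolding tree_w by simp
  also have "\<dots> = tree_gf ^ k * tree_w - fps_const 2 * (tree_gf ^ Suc k * tree_w)"
    by (simp add: algebra_simps numeral_fps_const)
  finally have "fps_nth (tree_gf ^ k) m = c - 2 * d"
    by (metis (no_types) c_def d_def fps_mult_left_const_nth fps_sub_nth)
  moreover have "real m * fps_nth (tree_gf ^ k) m = real k * (c - d)"
  proof -
    have "fps_X * fps_deriv (tree_gf ^ k) = fps_const (real k) * (tree_gf ^ k * tree_w - tree_gf ^ Suc k * tree_w)"
    proof (cases k)
      case (Suc j)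
      then show ?thesis
        unfolding fps_deriv_power tree_gf_eq[symmetric]
        by (simp add: deriv_tree_gf algebra_simps fps_of_nat)
    qed simp
    from arg_cong[OF this, of "\<lambda>f. fps_nth f m"] show ?thesis
      unfolding c_def d_def by (cases m) (simp_all del: power_Suc)
  qed
  ultimately have "real m * (c - 2 * d) = real k * (c - d)" by simp
  then show ?thesis unfolding c_def[symmetric] d_def[symmetric] by (simp add: algebra_simps)
qed

section \<open>Power series dominated by the Catalan numbers\<close>

lemma tree_gf_nth_nonneg: "fps_nth tree_gf m \<ge> 0"
  by (simp add: tree_gf_def wgf_nth)

text \<open>The summand \<open>1\<close> makes up for the vanishing constant term of
  \<open>tree_gf\<close>, so that constants are included.\<close>

definition catalan_bounded :: "real fps \<Rightarrow> bool" where
  "catalan_bounded g \<longleftrightarrow> (\<exists>K. \<forall>m. \<bar>fps_nth g m\<bar> \<le> K * fps_nth (1 + tree_gf) m)"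

lemma catalan_boundedI: "(\<And>m. \<bar>fps_nth g m\<bar> \<le> K * fps_nth (1 + tree_gf) m) \<Longrightarrow> catalan_bounded g"
  unfolding catalan_bounded_def by blast

lemma one_plus_tree_gf_nth_nonneg: "fps_nth (1 + tree_gf) m \<ge> 0"
  using tree_gf_nth_nonneg[of m] by simp

lemma catalan_bounded_const: "catalan_bounded (fps_const c)"
  by (rule catalan_boundedI[of _ "\<bar>c\<bar>"]) (simp add: tree_gf_nth_nonneg tree_gf_nth_0)

lemma catalan_bounded_tree_gf: "catalan_bounded tree_gf"
  by (rule catalan_boundedI[of _ 1]) (simp add: tree_gf_nth_nonneg)

lemma catalan_bounded_add:
  assumes "catalan_bounded f" "catalan_bounded g"
  shows "catalan_bounded (f + g)"
proof -
  obtain K L where *: "\<And>m. \<bar>fps_nth f m\<bar> \<le> K * fps_nth (1 + tree_gf) m"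
    "\<And>m. \<bar>fps_nth g m\<bar> \<le> L * fps_nth (1 + tree_gf) m"
    using assms unfolding catalan_bounded_def by blast
  have "\<bar>fps_nth (f + g) m\<bar> \<le> (K + L) * fps_nth (1 + tree_gf) m" for m
    unfolding fps_add_nth[of f g] distrib_right using *[of m] by linarith
  then show ?thesis by (rule catalan_boundedI)
qed

text \<open>The class is closed under products because \<open>(1 + T) ^ 2 = 1 + 3 T - z\<close>,
  whose coefficients are at most those of \<open>3 (1 + T)\<close>.\<close>

lemma catalan_bounded_mult:
  assumes "catalan_bounded f" "catalan_bounded g"
  shows "catalan_bounded (f * g)"
proof -
  obtain K L where *: "\<And>m. \<bar>fps_nth f m\<bar> \<le> K * fps_nth (1 + tree_gf) m"
    "\<And>m. \<bar>fps_nth g m\<bar> \<le> L * fps_nth (1 + tree_gf) m"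
    using assms unfolding catalan_bounded_def by blast
  have "\<bar>fps_nth f 0\<bar> \<le> K" "\<bar>fps_nth g 0\<bar> \<le> L"
    using *[of 0] by (simp_all add: tree_gf_nth_0)
  then have KL: "K \<ge> 0" "L \<ge> 0" by linarith+
  have "\<bar>fps_nth (f * g) m\<bar> \<le> (K * L * 3) * fps_nth (1 + tree_gf) m" for m
  proof -
    have "\<bar>fps_nth (f * g) m\<bar> \<le> (\<Sum>i=0..m. \<bar>fps_nth f i\<bar> * \<bar>fps_nth g (m - i)\<bar>)"
      unfolding fps_mult_nth abs_mult[symmetric] by (rule sum_abs)
    also have "\<dots> \<le> (\<Sum>i=0..m. (K * fps_nth (1 + tree_gf) i) * (L * fps_nth (1 + tree_gf) (m - i)))"
      by (intro sum_mono mult_mono *) (use KL one_plus_tree_gf_nth_nonneg in auto)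
    also have "\<dots> = K * L * fps_nth ((1 + tree_gf) * (1 + tree_gf)) m"
      unfolding fps_mult_nth sum_distrib_left by (simp add: mult_ac)
    also have "(1 + tree_gf) * (1 + tree_gf) = 1 + fps_const 3 * tree_gf - fps_X"
      unfolding tree_gf_eq[symmetric] by (simp add: algebra_simps flip: numeral_fps_const)
    also have "K * L * fps_nth (1 + fps_const 3 * tree_gf - fps_X) m \<le> K * L * (3 * fps_nth (1 + tree_gf) m)"
      by (rule mult_left_mono) (use KL tree_gf_nth_nonneg in \<open>auto simp: fps_X_def\<close>)
    finally show ?thesis by (simp only: mult.assoc)
  qed
  then show ?thesis by (rule catalan_boundedI)
qed

text \<open>\<open>1 - h\<close> counts the trees whose rightmost leaf has even depth, a subset of all trees.\<close>
lemma catalan_bounded_tree_h: "catalan_bounded tree_h"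
proof (rule catalan_boundedI[of _ 1])
  fix m
  define B where "B = cut_moment 0 0"
  have h: "tree_h = 1 - B" by (simp add: B_def cut_moment_0_0)
  have "fps_nth B m \<le> fps_nth tree_gf m"
    unfolding B_def cut_moment_0(1) tree_gf_def wgf_nth
    by (rule sum_mono2) (use finite_num_nodes_eq in auto)
  moreover have "fps_nth B m \<ge> 0"
    by (simp add: B_def cut_moment_0(1) wgf_nth)
  ultimately show "\<bar>fps_nth tree_h m\<bar> \<le> 1 * fps_nth (1 + tree_gf) m"
    unfolding h by auto
qed

section \<open>Truncated expansions in powers of \<open>s\<close>\<close>

definition tree_s :: "real fps" where "tree_s = 1 - 2 * tree_gf"

lemma catalan_bounded_tree_s: "catalan_bounded tree_s"
proof -
  have s: "tree_s = fps_const 1 + fps_const (-2) * tree_gf"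
    by (simp add: tree_s_def numeral_fps_const flip: fps_const_neg)
  show ?thesis
    unfolding s by (intro catalan_bounded_add catalan_bounded_mult catalan_bounded_const catalan_bounded_tree_gf)
qed

text \<open>Expansion at the dominant singularity \<open>z = 1/4\<close> in powers of \<open>s = sqrt (1 - 4 z)\<close>.\<close>
definition sing_expansion :: "real fps \<Rightarrow> real \<Rightarrow> real \<Rightarrow> real \<Rightarrow> bool" where
  "sing_expansion f a b c \<longleftrightarrow> (\<exists>g. catalan_bounded g \<and>
     f = fps_const a + fps_const b * tree_s + fps_const c * tree_s\<^sup>2 + tree_s ^ 3 * g)"

lemma sing_expansion_mult:
  assumes "sing_expansion f a b c" "sing_expansion f' a' b' c'"
  shows "sing_expansion (f * f') (a * a') (a * b' + b * a') (a * c' + b * b' + c * a')"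
proof -
  define A B C A' B' C' where "A = fps_const a" "B = fps_const b" "C = fps_const c"
    "A' = fps_const a'" "B' = fps_const b'" "C' = fps_const c'"
  note defs = this
  obtain g g' where g: "catalan_bounded g" "f = A + B * tree_s + C * tree_s\<^sup>2 + tree_s ^ 3 * g"
    and g': "catalan_bounded g'" "f' = A' + B' * tree_s + C' * tree_s\<^sup>2 + tree_s ^ 3 * g'"
    using assms unfolding sing_expansion_def defs by blast
  \<comment> \<open>All terms of the product of order at least \<open>s ^ 3\<close>, divided by
    \<open>s ^ 3\<close>.\<close>
  define h where "h = g * f' + A * g' + B * (tree_s * g') + C * (tree_s * (tree_s * g')) + B * C' + C * B' + C * (C' * tree_s)"
  have bd: "catalan_bounded A" "catalan_bounded B" "catalan_bounded C"
    "catalan_bounded A'" "catalan_bounded B'" "catalan_bounded C'"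
    by (simp_all add: defs catalan_bounded_const)
  note bd = bd g(1) g'(1) catalan_bounded_tree_s catalan_bounded_add catalan_bounded_mult
  have "catalan_bounded f'"
    unfolding g'(2) power2_eq_square power3_eq_cube by (intro bd)
  then have "catalan_bounded h"
    unfolding h_def by (intro bd)
  moreover have "f * f' = A * A' + (A * B' + B * A') * tree_s + (A * C' + B * B' + C * A') * tree_s\<^sup>2 + tree_s ^ 3 * h"
    unfolding h_def g(2) g'(2) by algebra
  moreover have "fps_const (a * a') = A * A'" "fps_const (a * b' + b * a') = A * B' + B * A'"
    "fps_const (a * c' + b * b' + c * a') = A * C' + B * B' + C * A'"
    by (simp_all add: defs)
  ultimately show ?thesis
    unfolding sing_expansion_def by metis
qed

lemma tree_gf_eq_s: "tree_gf = fps_const (1/2) - fps_const (1/2) * tree_s"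
proof -
  have "fps_const (1/2 :: real) * 2 = 1" by (simp add: numeral_fps_const)
  then show ?thesis by (simp add: tree_s_def right_diff_distrib flip: mult.assoc)
qed

lemma sing_expansion_tree_gf: "sing_expansion tree_gf (1/2) (-1/2) 0"
  unfolding sing_expansion_def using catalan_bounded_const[of 0] tree_gf_eq_s
  by (intro exI[of _ 0]) (simp flip: fps_const_neg)

lemma sing_expansion_one: "sing_expansion 1 1 0 0"
  unfolding sing_expansion_def using catalan_bounded_const[of 0] by (intro exI[of _ 0]) simp

text \<open>Since \<open>T = (1 - s) / 2\<close>, the coefficients are the first three of the
  binomial expansion of \<open>(1 - s) ^ k / 2 ^ k\<close>.\<close>

lemma sing_expansion_tree_gf_power:
  "sing_expansion (tree_gf ^ k) (1 / 2 ^ k) (- real k / 2 ^ k) (real k * (real k - 1) / 2 / 2 ^ k)"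
proof (induction k)
  case 0
  then show ?case by (simp add: sing_expansion_one)
next
  case (Suc k)
  have "(1/2) * (real k * (real k - 1) / 2 / 2 ^ k) + (-1/2) * (- real k / 2 ^ k) + 0 * (1 / 2 ^ k) =
      real (Suc k) * (real (Suc k) - 1) / 2 / 2 ^ Suc k"
    "(1/2) * (- real k / 2 ^ k) + (-1/2) * (1 / 2 ^ k) = - real (Suc k) / 2 ^ Suc k"
    by (simp_all add: field_simps)
  then show ?case
    using sing_expansion_mult[OF sing_expansion_tree_gf Suc] by simp
qed

text \<open>Here \<open>h = 2 / (3 - s)\<close> is a geometric series in \<open>s / 3\<close>.
  Iterating \<open>h = 2/3 + (s/3) h\<close> three times leaves the remainder
  \<open>s ^ 3 h / 27\<close>.\<close>

lemma sing_expansion_tree_h: "sing_expansion tree_h (2/3) (2/9) (2/27)"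
proof -
  have "1 + tree_gf = fps_const (3/2) - fps_const (1/2) * tree_s"
    by (simp add: tree_gf_eq_s fps_eq_iff)
  then have "(fps_const (3/2) - fps_const (1/2) * tree_s) * tree_h = 1"
    using tree_h by simp
  then have "fps_const (2/3) * (fps_const (3/2) * tree_h) = fps_const (2/3) * (1 + fps_const (1/2) * (tree_s * tree_h))"
    by (simp add: algebra_simps)
  then have "tree_h = fps_const (2/3) + fps_const (1/3) * (tree_s * tree_h)"
    by (simp add: algebra_simps flip: mult.assoc)
  then have eq: "tree_h = fps_const (2/3) + fps_const (1/3) * tree_s * tree_h"
    by (simp add: mult.assoc)
  define A where "A = fps_const (1/3 :: real)"
  have A: "fps_const (2/3) = 2 * A" "fps_const (2/9) = 2 * A\<^sup>2" "fps_const (2/27) = 2 * A ^ 3"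
    by (simp_all add: A_def numeral_fps_const power2_eq_square power3_eq_cube)
  have "tree_h = fps_const (2/3) + fps_const (2/9) * tree_s + fps_const (2/27) * tree_s\<^sup>2 + tree_s ^ 3 * (A ^ 3 * tree_h)"
    using eq unfolding A A_def[symmetric] by algebra
  moreover have "catalan_bounded (A ^ 3 * tree_h)"
    unfolding A_def fps_const_power
    by (intro catalan_bounded_mult catalan_bounded_const catalan_bounded_tree_h)
  ultimately show ?thesis unfolding sing_expansion_def by blast
qed

lemma sing_expansion_X_tree_h: "sing_expansion (fps_X * tree_h) (1/6) (1/18) (-4/27)"
proof -
  have "fps_const (1/4 :: real) * 4 = 1" by (simp add: numeral_fps_const)
  then have "fps_X = fps_const (1/4) - fps_const (1/4) * tree_s\<^sup>2"
    unfolding tree_s_def tree_s_square by (simp add: right_diff_distrib flip: mult.assoc)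
  then have "sing_expansion fps_X (1/4) 0 (-1/4)"
    unfolding sing_expansion_def using catalan_bounded_const[of 0]
    by (intro exI[of _ 0]) (simp flip: fps_const_neg)
  from sing_expansion_mult[OF this sing_expansion_tree_h] show ?thesis by simp
qed

lemma sing_expansion_scale:
  assumes "sing_expansion f a b c"
  shows "sing_expansion (fps_const d * f) (d * a) (d * b) (d * c)"
proof -
  have "sing_expansion (fps_const d) d 0 0"
    unfolding sing_expansion_def using catalan_bounded_const[of 0] by (intro exI[of _ 0]) simp
  from sing_expansion_mult[OF this assms] show ?thesis by simp
qed

text \<open>The quotient \<open>fps_nth tree_w m / (m + 1)\<close> is the Catalan number
  \<open>fps_nth tree_gf (m + 1)\<close>. It is at least \<open>fps_nth tree_gf m\<close> for
  \<open>m \<ge> 1\<close>, so dividing by it leaves the coefficients of \<open>g\<close>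
  bounded.\<close>

lemma catalan_bounded_imp_bigo:
  assumes "catalan_bounded g"
  shows "(\<lambda>m. real (m + 1) * fps_nth g m / fps_nth tree_w m) \<in> O(\<lambda>_. 1)"
proof -
  obtain K where K: "\<And>m. \<bar>fps_nth g m\<bar> \<le> K * fps_nth (1 + tree_gf) m"
    using assms unfolding catalan_bounded_def by blast
  have "\<bar>fps_nth g 0\<bar> \<le> K"
    using K[of 0] by (simp add: tree_gf_nth_0)
  then have "K \<ge> 0" by linarith
  have "\<bar>real (m + 1) * fps_nth g m / fps_nth tree_w m\<bar> \<le> K" if "m \<ge> 1" for m
  proof -
    obtain j where j: "m = Suc j" using \<open>m \<ge> 1\<close> by (cases m) auto
    have "fps_nth tree_gf m \<le> fps_nth tree_gf (Suc m)"
    proof -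
      have "fps_nth tree_gf m = fps_nth tree_w j / real m" by (simp add: j tree_gf_nth_Suc)
      moreover have "real m * fps_nth tree_w m = (4 * real j + 2) * fps_nth tree_w j"
        using tree_w_Suc[of j] by (simp add: j)
      moreover have "(real m + 1) * fps_nth tree_w j \<le> (4 * real j + 2) * fps_nth tree_w j"
        by (rule mult_right_mono) (use tree_w_pos[of j] in \<open>auto simp: j\<close>)
      ultimately show ?thesis
        by (simp add: tree_gf_nth_Suc field_simps j)
    qed
    then have "K * fps_nth (1 + tree_gf) m \<le> K * (fps_nth tree_w m / real (m + 1))"
      by (intro mult_left_mono \<open>K \<ge> 0\<close>) (use that in \<open>simp add: tree_gf_nth_Suc\<close>)
    with K[of m] have "\<bar>fps_nth g m\<bar> \<le> K * (fps_nth tree_w m / real (m + 1))" by linarith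
    then have "real (m + 1) * \<bar>fps_nth g m\<bar> / fps_nth tree_w m \<le> K"
      using tree_w_pos[of m] by (simp add: field_simps)
    then show ?thesis using tree_w_pos[of m] by (simp add: abs_mult)
  qed
  then show ?thesis
    by (intro bigoI[of _ K]) (auto simp: eventually_at_top_linorder intro!: exI[of _ 1])
qed

text \<open>What the second moment in \<open>ancestor_gf\<close> adds, inside the factor
  \<open>z ^ 2\<close>, to three times \<open>P w\<close>.\<close>

definition second_moment_gf :: "nat \<Rightarrow> real fps" where
  "second_moment_gf r = 2 * (tree_gf ^ (2 * r))\<^sup>2 * fps_X * tree_h * tree_w\<^sup>2
     + 6 * tree_gf ^ (2 * r) * tree_gf * fps_X * tree_h * tree_w ^ 3"

text \<open>The series is \<open>f1 w ^ 2 + f2 w ^ 3\<close>. Expanding \<open>f1\<close> and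
  \<open>f2\<close> in \<open>s\<close> and cancelling with \<open>s w = 1\<close> leaves multiples
  of \<open>w ^ 3\<close>, \<open>w ^ 2\<close> and \<open>w\<close> with factors \<open>A\<close>,
  \<open>B\<close> and \<open>C\<close>, plus a Catalan-bounded series.\<close>

lemma second_moment_coeff:
  fixes r :: nat
  defines "A \<equiv> 1 / (2 * 4 ^ r)" and "B \<equiv> (1 - 4 ^ r * (3 * real r + 1)) / (3 * 16 ^ r)"
    and "C \<equiv> (real r ^ 2 + real r / 6 - 11 / 18) / 4 ^ r - (4 * real r / 3 - 1 / 9) / 16 ^ r"
  shows "(\<lambda>m. real (m + 1) * fps_nth (second_moment_gf r) m / fps_nth tree_w m
     - real (m + 1) * (A * (2 * real m + 1) + B * (4 ^ m / fps_nth tree_w m) + C)) \<in> O(\<lambda>_. 1)"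
proof -
  define f1 where "f1 = fps_const 2 * (tree_gf ^ (4 * r) * (fps_X * tree_h))"
  define f2 where "f2 = fps_const 6 * (tree_gf ^ (2 * r + 1) * (fps_X * tree_h))"
  have ws: "tree_s * tree_w = 1" by (simp add: tree_s_def tree_w)
  have Y: "second_moment_gf r = f1 * tree_w\<^sup>2 + f2 * tree_w ^ 3"
    unfolding second_moment_gf_def f1_def f2_def
    by (simp add: numeral_fps_const power_mult[symmetric] mult_ac)
  define b0 b1 where "b0 = 1 / (3 * 16 ^ r :: real)" and "b1 = - (4 * real r / 3 - 1 / 9) / 16 ^ r"
  define a1 a2 where "a1 = - (real r + 1 / 3) / 4 ^ r" and "a2 = (real r ^ 2 + real r / 6 - 11 / 18) / 4 ^ r"
  have pow: "(2::real) ^ (4 * r) = 16 ^ r" "(2::real) ^ (2 * r + 1) = 2 * 4 ^ r"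
    by (simp_all add: power_mult)
  \<comment> \<open>The third coefficient enters only the bounded remainder, since
    \<open>s ^ 2 w ^ 2 = 1\<close>.\<close>
  obtain b2 where "sing_expansion f1 b0 b1 b2"
  proof
    have "2 * (1 / 2 ^ (4 * r) * (1 / 6)) = b0"
      "2 * (1 / 2 ^ (4 * r) * (1 / 18) + - real (4 * r) / 2 ^ (4 * r) * (1 / 6)) = b1"
      unfolding b0_def b1_def pow by (simp_all add: field_simps)
    then show "sing_expansion f1 b0 b1 (2 * (1 / 2 ^ (4 * r) * (- 4 / 27) + - real (4 * r) / 2 ^ (4 * r) * (1 / 18) +
       real (4 * r) * (real (4 * r) - 1) / 2 / 2 ^ (4 * r) * (1 / 6)))"
      using sing_expansion_scale[OF sing_expansion_mult[OF sing_expansion_tree_gf_power[of "4 * r"] sing_expansion_X_tree_h], of 2]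
      unfolding f1_def by metis
  qed
  then obtain g1 where g1: "catalan_bounded g1"
    "f1 = fps_const b0 + fps_const b1 * tree_s + fps_const b2 * tree_s\<^sup>2 + tree_s ^ 3 * g1"
    unfolding sing_expansion_def by blast
  have "sing_expansion f2 A a1 a2"
  proof -
    have "6 * (1 / 2 ^ (2 * r + 1) * (1 / 6)) = A"
      "6 * (1 / 2 ^ (2 * r + 1) * (1 / 18) + - real (2 * r + 1) / 2 ^ (2 * r + 1) * (1 / 6)) = a1"
      "6 * (1 / 2 ^ (2 * r + 1) * (- 4 / 27) + - real (2 * r + 1) / 2 ^ (2 * r + 1) * (1 / 18) +
       real (2 * r + 1) * (real (2 * r + 1) - 1) / 2 / 2 ^ (2 * r + 1) * (1 / 6)) = a2"
      unfolding A_def a1_def a2_def pow by (simp_all add: field_simps power2_eq_square)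
    then show ?thesis
      using sing_expansion_scale[OF sing_expansion_mult[OF sing_expansion_tree_gf_power[of "2 * r + 1"] sing_expansion_X_tree_h], of 6]
      unfolding f2_def by metis
  qed
  then obtain g2 where g2: "catalan_bounded g2"
    "f2 = fps_const A + fps_const a1 * tree_s + fps_const a2 * tree_s\<^sup>2 + tree_s ^ 3 * g2"
    unfolding sing_expansion_def by blast
  define g where "g = fps_const b2 + tree_s * g1 + g2"
  have g: "catalan_bounded g"
    unfolding g_def by (intro catalan_bounded_add catalan_bounded_mult catalan_bounded_const
        catalan_bounded_tree_s g1 g2)
  have "f1 * tree_w\<^sup>2 = fps_const b0 * tree_w\<^sup>2 + (tree_s * tree_w) * (fps_const b1 * tree_w)
       + (tree_s * tree_w)\<^sup>2 * (fps_const b2 + tree_s * g1)"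
    unfolding g1(2) by algebra
  moreover have "f2 * tree_w ^ 3 = fps_const A * tree_w ^ 3 + (tree_s * tree_w) * (fps_const a1 * tree_w\<^sup>2)
      + (tree_s * tree_w)\<^sup>2 * (fps_const a2 * tree_w) + (tree_s * tree_w) ^ 3 * g2"
    unfolding g2(2) by algebra
  ultimately have "second_moment_gf r = fps_const A * tree_w ^ 3 + fps_const (a1 + b0) * tree_w\<^sup>2
      + fps_const (a2 + b1) * tree_w + g"
    unfolding Y ws g_def by (simp add: algebra_simps flip: fps_const_add)
  moreover have "(16::real) ^ r = 4 ^ r * 4 ^ r"
    by (simp flip: power_mult_distrib)
  then have "a1 + b0 = B" "a2 + b1 = C"
    unfolding a1_def a2_def b0_def b1_def B_def C_def by (simp_all add: field_simps)
  ultimately have coeff: "fps_nth (second_moment_gf r) m =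
      A * ((2 * real m + 1) * fps_nth tree_w m) + B * 4 ^ m + C * fps_nth tree_w m + fps_nth g m" for m
    by (simp add: tree_w_cube_nth tree_w_square_nth)
  have "real (m + 1) * fps_nth (second_moment_gf r) m / fps_nth tree_w m
     - real (m + 1) * (A * (2 * real m + 1) + B * (4 ^ m / fps_nth tree_w m) + C)
     = real (m + 1) * fps_nth g m / fps_nth tree_w m" for m
    using tree_w_pos[of m] unfolding coeff by (simp add: field_simps)
  then show ?thesis using catalan_bounded_imp_bigo[OF g] by simp
qed

section \<open>Asymptotics\<close>

definition central_ratio :: "nat \<Rightarrow> real" where
  "central_ratio m = 4 ^ m / fps_nth tree_w m"

lemma central_ratio_pos: "central_ratio m > 0"
  by (simp add: central_ratio_def tree_w_pos)

lemma central_ratio_Suc: "central_ratio (Suc m) = central_ratio m * ((2 * real m + 2) / (2 * real m + 1))"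
proof -
  have "(4::real) ^ m * (2 * real m + 2) * fps_nth tree_w (Suc m) = 2 * 4 ^ m * (real (m + 1) * fps_nth tree_w (m + 1))"
    by (simp add: algebra_simps)
  also have "\<dots> = 4 ^ Suc m * (fps_nth tree_w m * (2 * real m + 1))"
    unfolding tree_w_Suc by (simp add: algebra_simps)
  finally have eq: "4 ^ Suc m * (fps_nth tree_w m * (2 * real m + 1)) = 4 ^ m * (2 * real m + 2) * fps_nth tree_w (Suc m)" ..
  have nz: "fps_nth tree_w m * (2 * real m + 1) \<noteq> 0" "fps_nth tree_w (Suc m) \<noteq> 0"
    using tree_w_pos[of m] tree_w_pos[of "Suc m"] by auto
  show ?thesis
    unfolding central_ratio_def times_divide_times_eq frac_eq_eq[OF nz(2,1)] by (rule eq)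
qed

lemma central_ratio_square_Suc:
  "(central_ratio (Suc m))\<^sup>2 = (central_ratio m)\<^sup>2 * ((2 * real m + 2)\<^sup>2 / (2 * real m + 1)\<^sup>2)"
  unfolding central_ratio_Suc power_mult_distrib power_divide ..

lemma central_ratio_wallis:
  "(\<Prod>k=1..n. (4 * real k ^ 2) / (4 * real k ^ 2 - 1)) = (central_ratio n)\<^sup>2 / (2 * real n + 1)"
proof (induction n)
  case 0
  then show ?case by (simp add: central_ratio_def tree_w_nth_0)
next
  case (Suc n)
  have *: "(2 * real n + 2)\<^sup>2 - 1 = (2 * real n + 1) * (2 * real n + 3)"
    "4 * real (Suc n) ^ 2 = (2 * real n + 2)\<^sup>2"
    by (simp_all add: power2_eq_square algebra_simps)
  have "(\<Prod>k=1..Suc n. (4 * real k ^ 2) / (4 * real k ^ 2 - 1)) =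
     (central_ratio n)\<^sup>2 / (2 * real n + 1) * ((2 * real n + 2)\<^sup>2 / ((2 * real n + 1) * (2 * real n + 3)))"
    using Suc by (simp add: * del: of_nat_Suc)
  also have "\<dots> = (central_ratio (Suc n))\<^sup>2 / (2 * real (Suc n) + 1)"
    unfolding central_ratio_square_Suc by (simp add: power2_eq_square add_ac)
  finally show ?case .
qed

text \<open>Wallis' product with limit \<open>pi / 2\<close>, for any normalisation \<open>d\<close>
  that is asymptotic to \<open>n\<close>; the two bounds below use different ones.\<close>

lemma central_ratio_limit:
  assumes "(\<lambda>n. (2 * real n + 1) / d n) \<longlonglongrightarrow> 2"
  shows "(\<lambda>n. (central_ratio n)\<^sup>2 / d n) \<longlonglongrightarrow> pi"
proof -
  have "(\<lambda>n. (central_ratio n)\<^sup>2 / (2 * real n + 1) * ((2 * real n + 1) / d n)) \<longlonglongrightarrow> pi / 2 * 2"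
    using wallis assms unfolding central_ratio_wallis by (rule tendsto_mult)
  moreover have "2 * real n + 1 \<noteq> 0" for n using of_nat_0_le_iff[of n] by linarith
  ultimately show ?thesis by simp
qed

text \<open>The quotient of the two sides without \<open>pi\<close> decreases to the limit
  \<open>pi\<close>, hence stays above it.\<close>

lemma central_ratio_lower: "pi * (real m + 1 / 4) \<le> (central_ratio m)\<^sup>2"
proof -
  define f where "f n = (central_ratio n)\<^sup>2 / (real n + 1 / 4)" for n
  have "decseq f"
  proof (rule decseq_SucI)
    fix n
    \<comment> \<open>The right side exceeds the left by exactly \<open>1/4\<close>.\<close>
    have "(2 * real n + 2)\<^sup>2 * (real n + 1 / 4) \<le> (2 * real n + 1)\<^sup>2 * (real n + 5 / 4)"
      by (simp add: power2_eq_square algebra_simps)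
    then have "(2 * real n + 2)\<^sup>2 / (2 * real n + 1)\<^sup>2 / (real n + 5 / 4) \<le> 1 / (real n + 1 / 4)"
      by (simp add: divide_le_eq pos_le_divide_eq mult_ac add_pos_pos)
    from mult_left_mono[OF this, of "(central_ratio n)\<^sup>2"] show "f (Suc n) \<le> f n"
      by (simp add: f_def central_ratio_square_Suc add_ac)
  qed
  moreover have "f \<longlonglongrightarrow> pi"
    unfolding f_def by (rule central_ratio_limit) real_asymp
  ultimately have "pi \<le> f m" by (rule decseq_ge)
  then show ?thesis by (simp add: f_def field_simps)
qed

text \<open>The extra term \<open>1 / (4 m)\<close> makes the quotient increase to
  \<open>pi\<close>. It is small enough to change \<open>(n - 1) * central_ratio (n - 2)\<close>
  only by \<open>O(n powr (-1/2))\<close>.\<close>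

lemma central_ratio_upper:
  assumes "m \<ge> 1"
  shows "(central_ratio m)\<^sup>2 \<le> pi * (real m + 1 / 4 + 1 / (4 * real m))"
proof -
  define d where "d n = real n + 1 / 4 + 1 / (4 * real n)" for n
  define f where "f n = (central_ratio (Suc n))\<^sup>2 / d (Suc n)" for n
  have d_pos: "d n > 0" for n by (simp add: d_def add_nonneg_pos add_pos_nonneg)
  have "incseq f"
  proof (rule incseq_SucI)
    fix k
    define n where "n = Suc k"
    have n: "real n \<ge> 1" by (simp add: n_def)
    \<comment> \<open>The right side exceeds the left by \<open>7 n ^ 2 + 10 n + 4\<close>; this is
      the comparison of \<open>d (Suc n)\<close> with \<open>d n\<close> after clearing
      denominators.\<close>
    have "(2 * real n + 1)\<^sup>2 * (4 * real n ^ 2 + 9 * real n + 6) * real n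
        \<le> (2 * real n + 2)\<^sup>2 * (4 * real n ^ 2 + real n + 1) * (real n + 1)"
      using n by (simp add: power2_eq_square algebra_simps)
    moreover have "d (Suc n) = (4 * real n ^ 2 + 9 * real n + 6) / (4 * (real n + 1))"
      "d n = (4 * real n ^ 2 + real n + 1) / (4 * real n)"
      using n by (simp_all add: d_def field_simps power2_eq_square)
    moreover have "P / (4 * (x + 1)) \<le> Q / (4 * x)" if "P * x \<le> Q * (x + 1)" "x \<ge> 1" for P Q x :: real
      using that by (simp add: field_simps)
    ultimately have "(2 * real n + 1)\<^sup>2 * d (Suc n) \<le> (2 * real n + 2)\<^sup>2 * d n"
      using n by simp
    then have "1 / d n \<le> (2 * real n + 2)\<^sup>2 / (2 * real n + 1)\<^sup>2 / d (Suc n)"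
      using d_pos[of n] d_pos[of "Suc n"] n by (simp add: divide_le_eq pos_le_divide_eq mult_ac)
    from mult_left_mono[OF this, of "(central_ratio n)\<^sup>2"] show "f k \<le> f (Suc k)"
      by (simp add: f_def central_ratio_square_Suc[of n, unfolded n_def] n_def)
  qed
  moreover have "f \<longlonglongrightarrow> pi"
    unfolding f_def
  proof (rule LIMSEQ_Suc)
    show "(\<lambda>n. (central_ratio n)\<^sup>2 / d n) \<longlonglongrightarrow> pi"
      unfolding d_def by (rule central_ratio_limit) real_asymp
  qed
  ultimately have "f (m - 1) \<le> pi" by (rule incseq_le)
  then show ?thesis using assms d_pos[of m] by (simp add: f_def d_def divide_le_eq)
qed

text \<open>For \<open>m = n - 2\<close> both bounds are \<open>sqrt (pi (n - 7/4))\<close> up to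
  lower order, and \<open>(1 - 1/n) (1 - 7/(8 n))\<close> yields the coefficient
  \<open>15/8 = 1 + 7/8\<close>.\<close>

lemma central_ratio_asymp:
  "(\<lambda>n. (real n - 1) * central_ratio (n - 2) - sqrt pi * (real n powr (3/2) - 15 / 8 * real n powr (1/2))) \<in> O(\<lambda>_. 1)"
proof -
  define l where "l n = (n - 1) * sqrt (pi * (n - 7 / 4))" for n :: real
  define u where "u n = (n - 1) * sqrt (pi * (n - 7 / 4 + 1 / (4 * (n - 2))))" for n :: real
  define t where "t n = sqrt pi * (n powr (3/2) - 15 / 8 * n powr (1/2))" for n :: real
  have "(\<lambda>n. l (real n) - t (real n)) \<in> O(\<lambda>_. 1)" "(\<lambda>n. u (real n) - t (real n)) \<in> O(\<lambda>_. 1)"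
    unfolding l_def u_def t_def real_sqrt_mult by real_asymp+
  then have "(\<lambda>n. \<bar>l (real n) - t (real n)\<bar> + \<bar>u (real n) - t (real n)\<bar>) \<in> O(\<lambda>_. 1)"
    by (intro sum_in_bigo) simp_all
  note bound = this
  have "\<forall>\<^sub>F n in at_top. norm ((real n - 1) * central_ratio (n - 2) - t (real n))
      \<le> norm (\<bar>l (real n) - t (real n)\<bar> + \<bar>u (real n) - t (real n)\<bar>)"
    using eventually_ge_at_top[of 3]
  proof eventually_elim
    case (elim n)
    have n: "real (n - 2) = real n - 2" using elim by simp
    have "sqrt (pi * (real n - 7 / 4)) \<le> central_ratio (n - 2)"
      using central_ratio_lower[of "n - 2"] central_ratio_pos[of "n - 2"]
      by (intro real_le_lsqrt) (simp_all add: n)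
    moreover have "central_ratio (n - 2) \<le> sqrt (pi * (real n - 7 / 4 + 1 / (4 * (real n - 2))))"
      using central_ratio_upper[of "n - 2"] elim by (intro real_le_rsqrt) (simp add: n)
    ultimately have "l (real n) \<le> (real n - 1) * central_ratio (n - 2)" "(real n - 1) * central_ratio (n - 2) \<le> u (real n)"
      unfolding l_def u_def using elim by (auto intro!: mult_left_mono)
    then show ?case by auto
  qed
  from landau_o.big.trans[OF landau_o.big_mono[OF this] bound] show ?thesis
    unfolding t_def .
qed

section \<open>Expansions in powers of \<open>1 / n\<close> with third-order error\<close>

definition expansion2 :: "(nat \<Rightarrow> real) \<Rightarrow> real \<Rightarrow> real \<Rightarrow> real \<Rightarrow> bool" where
  "expansion2 f a b c \<longleftrightarrow> (\<lambda>n. f n - (a + b / real n + c / real n ^ 2)) \<in> O(\<lambda>n. 1 / real n ^ 3)"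

lemma expansion2_mult:
  assumes "expansion2 f a b c" "expansion2 g a' b' c'"
  shows "expansion2 (\<lambda>n. f n * g n) (a * a') (a * b' + b * a') (a * c' + b * b' + c * a')"
proof -
  define F where "F n = f n - (a + b / real n + c / real n ^ 2)" for n
  define G where "G n = g n - (a' + b' / real n + c' / real n ^ 2)" for n
  have F: "F \<in> O(\<lambda>n. 1 / real n ^ 3)" and G: "G \<in> O(\<lambda>n. 1 / real n ^ 3)"
    using assms unfolding expansion2_def F_def G_def by auto
  have poly: "(\<lambda>n. a + b / real n + c / real n ^ 2) \<in> O(\<lambda>_. 1)" for a b c :: real
    by (intro sum_in_bigo) real_asymp+
  have "G \<in> O(\<lambda>_. 1)"
    by (rule landau_o.big.trans[OF G]) real_asymp
  then have "(\<lambda>n. G n + (a' + b' / real n + c' / real n ^ 2)) \<in> O(\<lambda>_. 1)"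
    by (intro sum_in_bigo(1) poly)
  then have "g \<in> O(\<lambda>_. 1)" by (simp add: G_def)
  then have 1: "(\<lambda>n. F n * g n) \<in> O(\<lambda>n. 1 / real n ^ 3)"
    using landau_o.big.mult[OF F, of g "\<lambda>_. 1"] by simp
  have 2: "(\<lambda>n. (a + b / real n + c / real n ^ 2) * G n) \<in> O(\<lambda>n. 1 / real n ^ 3)"
    using landau_o.big.mult[OF poly G] by simp
  have 3: "(\<lambda>n. (b * c' + c * b') / real n ^ 3 + c * c' / real n ^ 4) \<in> O(\<lambda>n. 1 / real n ^ 3)"
    by (intro sum_in_bigo) real_asymp+
  \<comment> \<open>With \<open>p\<close>, \<open>q\<close> the truncations of \<open>f\<close>,
    \<open>g\<close>, one has \<open>f g - p q = F g + p G\<close>; the last summand holds the terms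
    of \<open>p q\<close> of orders 3 and 4.\<close>
  have "(\<lambda>n. F n * g n + (a + b / real n + c / real n ^ 2) * G n
       + ((b * c' + c * b') / real n ^ 3 + c * c' / real n ^ 4)) \<in> O(\<lambda>n. 1 / real n ^ 3)"
    by (intro sum_in_bigo(1) 1 2 3)
  moreover have "F n * g n + (a + b / real n + c / real n ^ 2) * G n
       + ((b * c' + c * b') / real n ^ 3 + c * c' / real n ^ 4) =
     f n * g n - (a * a' + (a * b' + b * a') / real n + (a * c' + b * b' + c * a') / real n ^ 2)" for n
    by (cases "n = 0") (simp_all add: F_def G_def field_simps power2_eq_square power3_eq_cube power4_eq_xxxx)
  ultimately show ?thesis unfolding expansion2_def by simp
qed

text \<open>The geometric series with its exact remainder
  \<open>d ^ 3 / n ^ 3 * (1 / (1 - d / n))\<close>.\<close>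

lemma expansion2_inverse: "expansion2 (\<lambda>n. 1 / (1 - d / real n)) 1 d (d\<^sup>2)"
proof -
  have "(\<lambda>n. 1 / (1 - d / real n)) \<in> O(\<lambda>_. 1)" by real_asymp
  moreover have "(\<lambda>n. d ^ 3 / real n ^ 3) \<in> O(\<lambda>n. 1 / real n ^ 3)" by real_asymp
  ultimately have "(\<lambda>n. d ^ 3 / real n ^ 3 * (1 / (1 - d / real n))) \<in> O(\<lambda>n. 1 / real n ^ 3 * 1)"
    by (rule landau_o.big.mult[rotated])
  moreover have "\<forall>\<^sub>F n in at_top. d ^ 3 / real n ^ 3 * (1 / (1 - d / real n)) =
      1 / (1 - d / real n) - (1 + d / real n + d\<^sup>2 / real n ^ 2)"
    using eventually_gt_at_top[of "nat \<lceil>\<bar>d\<bar>\<rceil>"]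
  proof eventually_elim
    case (elim n)
    then have "real n > \<bar>d\<bar>" by linarith
    then have "real n > 0" "real n - d \<noteq> 0" by auto
    then show ?case by (simp add: field_simps power2_eq_square power3_eq_cube)
  qed
  ultimately show ?thesis
    unfolding expansion2_def by (simp add: landau_o.big.in_cong)
qed

lemma expansion2_cong:
  assumes "\<forall>\<^sub>F n in at_top. f n = g n" "expansion2 f a b c"
  shows "expansion2 g a b c"
  using assms(2) unfolding expansion2_def
  by (subst (asm) landau_o.big.in_cong) (use assms(1) in \<open>auto elim: eventually_mono\<close>)

text \<open>
  Trees of size \<open>n\<close> correspond to the coefficient of \<open>z ^ (n - 2)\<close>, as their generating functions carry a factor
  \<open>z\<^sup>2\<close>; the subtraction is truncated, so only the values for \<open>n \<ge> 2\<close> matter.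
\<close>
definition power_ratio :: "nat \<Rightarrow> nat \<Rightarrow> real" where
  "power_ratio k n = fps_nth (tree_gf ^ k * tree_w) (n - 2) / fps_nth tree_w (n - 2)"

text \<open>By \<open>tree_gf_power_w_Suc\<close> with \<open>m = n - 2\<close>, consecutive ratios
  differ by the factor \<open>(m - k) / (2 m - k)\<close>. Dividing both its parts by
  \<open>2 n\<close> gives the two factors expanded in the induction step, whence
  \<open>d = k / 2 + 2\<close>.\<close>

lemma expansion2_power_ratio:
  "expansion2 (power_ratio k) (1 / 2 ^ k) (- (real k * (real k - 1) / 4) / 2 ^ k)
     (real k * (real k - 1) * (real k ^ 2 - 5 * real k - 14) / 32 / 2 ^ k)"
proof (induction k)
  case 0
  have "power_ratio 0 = (\<lambda>_. 1)"
    using tree_w_pos by (auto simp: power_ratio_def fun_eq_iff less_imp_neq[symmetric])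
  then show ?case by (simp add: expansion2_def)
next
  case (Suc k)
  define d where "d = real k / 2 + 2"
  have 1: "expansion2 (\<lambda>n. 1 / 2 - (real k + 2) / 2 / real n) (1/2) (- (real k + 2) / 2) 0"
  proof -
    have "1 / 2 - (real k + 2) / 2 / real n - (1 / 2 + (- (real k + 2) / 2) / real n + 0 / real n ^ 2) = 0" for n
      by (simp add: add_divide_distrib diff_divide_distrib)
    then show ?thesis unfolding expansion2_def by simp
  qed
  have "\<forall>\<^sub>F n in at_top. power_ratio k n * ((1 / 2 - (real k + 2) / 2 / real n) * (1 / (1 - d / real n))) = power_ratio (Suc k) n"
    using eventually_gt_at_top[of "k + 4"]
  proof eventually_elim
    case (elim n)
    define m where "m = n - 2"
    have m: "real m = real n - 2" using elim by (simp add: m_def)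
    have pos: "2 * real m - real k > 0" using elim by (simp add: m)
    have "1 / 2 - (real k + 2) / 2 / real n = (real m - real k) / (2 * real n)"
      "1 - d / real n = (2 * real m - real k) / (2 * real n)"
      using elim by (simp_all add: m d_def field_simps)
    then have "(1 / 2 - (real k + 2) / 2 / real n) * (1 / (1 - d / real n)) = (real m - real k) / (2 * real m - real k)"
      using elim by simp
    moreover have "fps_nth (tree_gf ^ Suc k * tree_w) m =
        (real m - real k) / (2 * real m - real k) * fps_nth (tree_gf ^ k * tree_w) m"
      using tree_gf_power_w_Suc[of m k] pos by (simp add: field_simps del: power_Suc)
    ultimately show ?case by (simp add: power_ratio_def m_def[symmetric] mult_ac del: power_Suc)
  qed
  note step = expansion2_cong[OF this expansion2_mult[OF Suc expansion2_mult[OF 1 expansion2_inverse]]]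
  have subst: "expansion2 f a' b' c'" if "expansion2 f a b c" "a = a'" "b = b'" "c = c'" for f a b c a' b' c'
    using that by simp
  show ?case
  proof (rule subst[OF step])
    define x where "x = real k"
    define P where "P = (1 / 2 ^ k :: real)"
    have x: "real (Suc k) = x + 1" "d = x / 2 + 2" by (simp_all add: x_def d_def)
    have P: "u / 2 ^ k = u * P" "u / 2 ^ Suc k = u * P / 2" for u by (simp_all add: P_def)
    show "1 / 2 ^ k * (1 / 2 * 1) = (1 / 2 ^ Suc k :: real)" by simp
    show "1 / 2 ^ k * (1 / 2 * d + - (real k + 2) / 2 * 1) + - (real k * (real k - 1) / 4) / 2 ^ k * (1 / 2 * 1) =
        - (real (Suc k) * (real (Suc k) - 1) / 4) / 2 ^ Suc k"
      unfolding P x x_def[symmetric] by (simp add: field_simps)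
    show "1 / 2 ^ k * (1 / 2 * d\<^sup>2 + - (real k + 2) / 2 * d + 0 * 1) +
        - (real k * (real k - 1) / 4) / 2 ^ k * (1 / 2 * d + - (real k + 2) / 2 * 1) +
        real k * (real k - 1) * ((real k)\<^sup>2 - 5 * real k - 14) / 32 / 2 ^ k * (1 / 2 * 1) =
        real (Suc k) * (real (Suc k) - 1) * ((real (Suc k))\<^sup>2 - 5 * real (Suc k) - 14) / 32 / 2 ^ Suc k"
      unfolding P x x_def[symmetric] by (simp add: field_simps power2_eq_square)
  qed
qed

section \<open>Mean and variance of the ancestor size\<close>

text \<open>Divided by the number \<open>C\<close> of trees, the first two moments are
  \<open>1 + e\<close> and \<open>1 + 3 e + y\<close>; the variance is their difference
  \<open>1 + 3 e + y - (1 + e) ^ 2\<close>.\<close>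

lemma random_cs_tree_moments:
  fixes n r :: nat
  assumes "n \<ge> 2"
  defines "e \<equiv> (real n - 1) * power_ratio (2 * r) n"
    and "y \<equiv> (real n - 1) * fps_nth (second_moment_gf r) (n - 2) / fps_nth tree_w (n - 2)"
  shows "measure_pmf.expectation (random_cs_tree n) (ancestor_size r) = 1 + e"
    and "measure_pmf.variance (random_cs_tree n) (ancestor_size r) = e - e\<^sup>2 + y"
proof -
  obtain m where n: "n = Suc (Suc m)" using assms(1) by (metis Suc_le_D numeral_2_eq_2 Suc_le_mono)
  define X where "X = ancestor_size r"
  define S where "S = catalan_stanley_trees n"
  define C where "C = fps_nth tree_w m / (real m + 1)"
  have S: "finite S" "S \<noteq> {}"
    using assms(1) by (auto simp: S_def finite_catalan_stanley_trees catalan_stanley_trees_nonempty)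
  have coeff: "(\<Sum>t\<in>S. g t) = fps_nth (wgf num_nodes {t. catalan_stanley t} g) n" for g
    by (simp add: S_def catalan_stanley_trees_def wgf_nth)
  have C: "(\<Sum>t\<in>S. 1) = C"
    unfolding coeff ancestor_gf(1) by (simp add: n tree_gf_nth_Suc C_def)
  have "C > 0" by (simp add: C_def tree_w_pos)
  have m: "n - 2 = m" "real n - 1 = real m + 1" by (simp_all add: n)
  have nz: "fps_nth tree_w m \<noteq> 0" "real m + 1 \<noteq> 0" using tree_w_pos[of m] by auto
  have shift: "fps_nth (fps_X\<^sup>2 * f) n = fps_nth f m" for f :: "real fps"
    by (simp add: n fps_X_power_mult_nth)
  have "(\<Sum>t\<in>S. X t) = C + fps_nth (tree_gf ^ (2 * r) * tree_w) m"
    unfolding C[symmetric] coeff X_def ancestor_gf(2) fps_add_nth shift ..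
  also have "fps_nth (tree_gf ^ (2 * r) * tree_w) m = C * e"
    unfolding e_def C_def power_ratio_def m using nz by simp
  finally have 1: "(\<Sum>t\<in>S. X t) = C * (1 + e)" by (simp add: algebra_simps)
  have "(\<Sum>t\<in>S. (X t)\<^sup>2) = C + (3 * fps_nth (tree_gf ^ (2 * r) * tree_w) m + fps_nth (second_moment_gf r) m)"
    unfolding C[symmetric] coeff X_def ancestor_gf(3) fps_add_nth shift second_moment_gf_def[symmetric]
    by (simp add: numeral_fps_const)
  also have "fps_nth (tree_gf ^ (2 * r) * tree_w) m = C * e"
    unfolding e_def C_def power_ratio_def m using nz by simp
  also have "fps_nth (second_moment_gf r) m = C * y"
    unfolding y_def C_def m using nz by simp
  finally have 2: "(\<Sum>t\<in>S. (X t)\<^sup>2) = C * (1 + 3 * e + y)" by (simp add: algebra_simps)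
  have card: "real (card S) = C" using C by simp
  have expect: "measure_pmf.expectation (random_cs_tree n) g = (\<Sum>t\<in>S. g t) / C" for g :: "plane_tree \<Rightarrow> real"
    unfolding random_cs_tree_def S_def[symmetric] card[symmetric] by (rule integral_pmf_of_set[OF S(2,1)])
  show E: "measure_pmf.expectation (random_cs_tree n) (ancestor_size r) = 1 + e"
    using \<open>C > 0\<close> 1 by (simp add: expect X_def)
  have "integrable (measure_pmf (random_cs_tree n)) f" for f :: "plane_tree \<Rightarrow> real"
    by (rule integrable_measure_pmf_finite)
       (simp add: random_cs_tree_def S_def[symmetric] set_pmf_of_set[OF S(2,1)] S)
  then have "measure_pmf.variance (random_cs_tree n) X =
      measure_pmf.expectation (random_cs_tree n) (\<lambda>t. (X t)\<^sup>2) - (measure_pmf.expectation (random_cs_tree n) X)\<^sup>2"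
    by (intro measure_pmf.variance_eq) auto
  also have "\<dots> = (1 + 3 * e + y) - (1 + e)\<^sup>2"
    using \<open>C > 0\<close> by (simp add: expect 1 2)
  also have "\<dots> = e - e\<^sup>2 + y" by (simp add: power2_eq_square algebra_simps)
  finally show "measure_pmf.variance (random_cs_tree n) (ancestor_size r) = e - e\<^sup>2 + y"
    by (simp add: X_def)
qed

text \<open>Multiplication by \<open>n - 1\<close> gives \<beta> = \<open>b\<close> - \<alpha> and
  \<gamma> = \<open>c - b\<close>. It costs one power of \<open>n\<close>, so the third-order error
  becomes second-order and absorbs the leftover \<open>- c / n ^ 2\<close>.\<close>

lemma mean_term_asymp:
  fixes r :: nat
  defines "\<alpha> \<equiv> 1 / 4 ^ r :: real" and "\<beta> \<equiv> (- 2 * real r ^ 2 + real r - 2) / (2 * 4 ^ r)"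
    and "\<gamma> \<equiv> (2 * real r + 1) * (2 * real r - 1) * (real r - 3) * real r / (2 * 4 ^ (r + 1))"
  shows "(\<lambda>n. (real n - 1) * power_ratio (2 * r) n - (\<alpha> * real n + \<beta> + \<gamma> / real n)) \<in> O(\<lambda>n. 1 / real n ^ 2)"
proof -
  define k where "k = 2 * real r"
  define b where "b = - (k * (k - 1) / 4) / 4 ^ r"
  define c where "c = k * (k - 1) * (k ^ 2 - 5 * k - 14) / 32 / 4 ^ r"
  define \<delta> where "\<delta> n = power_ratio (2 * r) n - (\<alpha> + b / real n + c / real n ^ 2)" for n
  have pow: "(2::real) ^ (2 * r) = 4 ^ r" by (simp add: power_mult)
  have "\<delta> \<in> O(\<lambda>n. 1 / real n ^ 3)"
    using expansion2_power_ratio[of "2 * r"]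
    unfolding expansion2_def pow \<delta>_def \<alpha>_def b_def c_def k_def by simp
  then have "(\<lambda>n. (real n - 1) * \<delta> n) \<in> O(\<lambda>n. real n * (1 / real n ^ 3))"
    by (intro landau_o.big.mult) (simp_all, real_asymp)
  also have "(\<lambda>n. real n * (1 / real n ^ 3)) \<in> O(\<lambda>n. 1 / real n ^ 2)"
    by real_asymp
  finally have "(\<lambda>n. (real n - 1) * \<delta> n - c / real n ^ 2) \<in> O(\<lambda>n. 1 / real n ^ 2)"
    by (intro sum_in_bigo) (simp, real_asymp)
  moreover have coeffs: "\<beta> = b - \<alpha>" "\<gamma> = c - b"
  proof -
    have p: "- (k * (k - 1) / 4) - 1 = (- 2 * real r ^ 2 + real r - 2) / 2"
      by (simp add: k_def field_simps power2_eq_square)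
    show "\<beta> = b - \<alpha>"
      unfolding b_def \<alpha>_def \<beta>_def diff_divide_distrib[symmetric] p by simp
    have q: "k * (k - 1) * (k ^ 2 - 5 * k - 14) / 32 - (- (k * (k - 1) / 4)) =
        (2 * real r + 1) * (2 * real r - 1) * (real r - 3) * real r / 8"
      by (simp add: k_def field_simps power2_eq_square)
    show "\<gamma> = c - b"
      unfolding b_def c_def \<gamma>_def diff_divide_distrib[symmetric] q by simp
  qed
  have "\<forall>\<^sub>F n in at_top. (real n - 1) * power_ratio (2 * r) n - (\<alpha> * real n + \<beta> + \<gamma> / real n) =
      (real n - 1) * \<delta> n - c / real n ^ 2"
    using eventually_gt_at_top[of 0]
    by eventually_elim (simp add: coeffs \<delta>_def field_simps power2_eq_square)
  ultimately show ?thesis by (simp only: landau_o.big.in_cong)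
qed


theorem mainTheorem11:
  fixes r :: nat
  shows "((\<lambda>n. measure_pmf.expectation (random_cs_tree n) (ancestor_size r)
            - (1 / 4 ^ r * real n
               + (2 * 4 ^ r - 2 * real r ^ 2 + real r - 2) / (2 * 4 ^ r)
               + (2 * real r + 1) * (2 * real r - 1) * (real r - 3) * real r / (2 * 4 ^ (r + 1))
                 * real n powr (-1)))
         \<in> O(\<lambda>n. real n powr (-3/2)))
       \<and> ((\<lambda>n. measure_pmf.variance (random_cs_tree n) (ancestor_size r)
            - ((2 ^ r + 1) * (2 ^ r - 1) / 16 ^ r * real n ^ 2
               - sqrt pi * (4 ^ r * (3 * real r + 1) - 1) / (3 * 16 ^ r) * real n powr (3/2)
               + (18 * 4 ^ r * real r ^ 2 + 3 * 4 ^ r * real r - 38 * 4 ^ r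
                    + 36 * real r ^ 2 - 42 * real r + 38) / (18 * 16 ^ r) * real n
               + 5 * sqrt pi * (4 ^ r * (3 * real r + 1) - 1) / (8 * 16 ^ r) * real n powr (1/2)))
         \<in> O(\<lambda>n. 1))"
proof
  define \<alpha> \<beta> \<gamma> where "\<alpha> = (1 / 4 ^ r :: real)" and "\<beta> = (- 2 * real r ^ 2 + real r - 2) / (2 * 4 ^ r)"
    and "\<gamma> = (2 * real r + 1) * (2 * real r - 1) * (real r - 3) * real r / (2 * 4 ^ (r + 1))"
  define e where "e n = (real n - 1) * power_ratio (2 * r) n" for n
  define y where "y n = (real n - 1) * fps_nth (second_moment_gf r) (n - 2) / fps_nth tree_w (n - 2)" for n
  have e: "(\<lambda>n. e n - (\<alpha> * real n + \<beta> + \<gamma> / real n)) \<in> O(\<lambda>n. 1 / real n ^ 2)"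
    using mean_term_asymp[of r] unfolding e_def \<alpha>_def \<beta>_def \<gamma>_def .
  have "(\<lambda>n. e n - (\<alpha> * real n + \<beta> + \<gamma> / real n)) \<in> O(\<lambda>n. real n powr (-3/2))"
    by (rule landau_o.big.trans[OF e]) real_asymp
  moreover have "\<forall>\<^sub>F n in at_top. measure_pmf.expectation (random_cs_tree n) (ancestor_size r)
            - (1 / 4 ^ r * real n
               + (2 * 4 ^ r - 2 * real r ^ 2 + real r - 2) / (2 * 4 ^ r)
               + (2 * real r + 1) * (2 * real r - 1) * (real r - 3) * real r / (2 * 4 ^ (r + 1))
                 * real n powr (-1)) = e n - (\<alpha> * real n + \<beta> + \<gamma> / real n)"
    using eventually_ge_at_top[of 2]
  proof eventually_elim
    case (elim n)
    have "(2 * 4 ^ r - 2 * real r ^ 2 + real r - 2) / (2 * 4 ^ r) = 1 + \<beta>"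
      by (simp add: \<beta>_def field_simps)
    moreover have "real n powr (-1) = 1 / real n"
      using elim by (simp add: powr_minus_divide)
    ultimately show ?case
      unfolding random_cs_tree_moments(1)[OF elim] e_def[symmetric] \<gamma>_def[symmetric]
      by (simp add: \<alpha>_def)
  qed
  ultimately show "(\<lambda>n. measure_pmf.expectation (random_cs_tree n) (ancestor_size r)
            - (1 / 4 ^ r * real n
               + (2 * 4 ^ r - 2 * real r ^ 2 + real r - 2) / (2 * 4 ^ r)
               + (2 * real r + 1) * (2 * real r - 1) * (real r - 3) * real r / (2 * 4 ^ (r + 1))
                 * real n powr (-1))) \<in> O(\<lambda>n. real n powr (-3/2))"
    by (simp only: landau_o.big.in_cong)

  define A B C where "A = (1 / (2 * 4 ^ r) :: real)" and "B = (1 - 4 ^ r * (3 * real r + 1)) / (3 * 16 ^ r)"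
    and "C = (real r ^ 2 + real r / 6 - 11 / 18) / 4 ^ r - (4 * real r / 3 - 1 / 9) / 16 ^ r"
  \<comment> \<open>For the variance \<open>e\<close> is needed up to \<open>O(1 / n)\<close> only:
    in its square the error meets a factor of order \<open>n\<close> and stays bounded.\<close>
  define \<delta> where "\<delta> n = e n - (\<alpha> * real n + \<beta>)" for n
  have "(\<lambda>n. (e n - (\<alpha> * real n + \<beta> + \<gamma> / real n)) + \<gamma> / real n) \<in> O(\<lambda>n. 1 / real n)"
    by (intro sum_in_bigo(1) landau_o.big.trans[OF e]) real_asymp+
  moreover have "(e n - (\<alpha> * real n + \<beta> + \<gamma> / real n)) + \<gamma> / real n = \<delta> n" for n
    by (simp add: \<delta>_def)
  ultimately have \<delta>: "\<delta> \<in> O(\<lambda>n. 1 / real n)" by simp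
  have \<delta>1: "\<delta> \<in> O(\<lambda>_. 1)"
    by (rule landau_o.big.trans[OF \<delta>]) real_asymp
  have "(\<lambda>n. real n * \<delta> n) \<in> O(\<lambda>n. real n * (1 / real n))"
    by (intro landau_o.big.mult \<delta>) simp
  also have "(\<lambda>n. real n * (1 / real n)) \<in> O(\<lambda>_. 1)" by real_asymp
  finally have \<delta>n: "(\<lambda>n. real n * \<delta> n) \<in> O(\<lambda>_. 1)" .
  have \<delta>2: "(\<lambda>n. \<delta> n * \<delta> n) \<in> O(\<lambda>_. 1)"
    using landau_o.big.mult[OF \<delta>1 \<delta>1] by simp
  \<comment> \<open>This is \<open>e - e ^ 2\<close> without its terms in \<open>n ^ 2\<close> and
    \<open>n\<close>.\<close>
  have square: "(\<lambda>n. (\<beta> - \<beta>\<^sup>2) + ((1 - 2 * \<beta>) * \<delta> n - 2 * \<alpha> * (real n * \<delta> n) - \<delta> n * \<delta> n)) \<in> O(\<lambda>_. 1)"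
  proof -
    have "(\<lambda>n. (1 - 2 * \<beta>) * \<delta> n) \<in> O(\<lambda>_. 1)" "(\<lambda>n. 2 * \<alpha> * (real n * \<delta> n)) \<in> O(\<lambda>_. 1)"
      by (rule landau_o.big.mult_in_1; use \<delta>1 \<delta>n in simp)+
    then show ?thesis
      by (intro sum_in_bigo \<delta>2) simp_all
  qed
  have y: "(\<lambda>n. y n - (real n - 1) * (A * (2 * real n - 3) + B * central_ratio (n - 2) + C)) \<in> O(\<lambda>_. 1)"
  proof -
    have "filterlim (\<lambda>n::nat. n - 2) at_top at_top"
      by (rule filterlim_minus_const_nat_at_top)
    from landau_o.big.compose[OF second_moment_coeff[of r] this]
    have "(\<lambda>n. real (n - 2 + 1) * fps_nth (second_moment_gf r) (n - 2) / fps_nth tree_w (n - 2)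
      - real (n - 2 + 1) * (A * (2 * real (n - 2) + 1) + B * central_ratio (n - 2) + C)) \<in> O(\<lambda>_. 1)"
      unfolding A_def B_def C_def central_ratio_def .
    moreover have "\<forall>\<^sub>F n in at_top. real (n - 2 + 1) * fps_nth (second_moment_gf r) (n - 2) / fps_nth tree_w (n - 2)
      - real (n - 2 + 1) * (A * (2 * real (n - 2) + 1) + B * central_ratio (n - 2) + C) =
      y n - (real n - 1) * (A * (2 * real n - 3) + B * central_ratio (n - 2) + C)"
      using eventually_ge_at_top[of 2]
    proof eventually_elim
      case (elim n)
      then have "real (n - 2 + 1) = real n - 1" "2 * real (n - 2) + 1 = 2 * real n - 3" by auto
      then show ?case by (simp only: y_def)
    qed
    ultimately show ?thesis by (simp only: landau_o.big.in_cong)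
  qed
  define t where "t n = (real n - 1) * central_ratio (n - 2)
     - sqrt pi * (real n powr (3/2) - 15 / 8 * real n powr (1/2))" for n
  have t: "(\<lambda>n. B * t n) \<in> O(\<lambda>_. 1)"
    using central_ratio_asymp unfolding t_def by simp
  define v where "v n = y n - (real n - 1) * (A * (2 * real n - 3) + B * central_ratio (n - 2) + C)" for n
  define u where "u n = (\<beta> - \<beta>\<^sup>2) + ((1 - 2 * \<beta>) * \<delta> n - 2 * \<alpha> * (real n * \<delta> n) - \<delta> n * \<delta> n)" for n
  \<comment> \<open>The constant \<open>3 * A - C\<close> is the constant term of
    \<open>(n - 1) (A (2 n - 3) + C)\<close>.\<close>
  have "(\<lambda>n. u n + v n + B * t n + (3 * A - C)) \<in> O(\<lambda>_. 1)"
    using square y t unfolding u_def[symmetric] v_def[symmetric] by (intro sum_in_bigo(1)) simp_all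
  moreover have "\<forall>\<^sub>F n in at_top. measure_pmf.variance (random_cs_tree n) (ancestor_size r)
            - ((2 ^ r + 1) * (2 ^ r - 1) / 16 ^ r * real n ^ 2
               - sqrt pi * (4 ^ r * (3 * real r + 1) - 1) / (3 * 16 ^ r) * real n powr (3/2)
               + (18 * 4 ^ r * real r ^ 2 + 3 * 4 ^ r * real r - 38 * 4 ^ r
                    + 36 * real r ^ 2 - 42 * real r + 38) / (18 * 16 ^ r) * real n
               + 5 * sqrt pi * (4 ^ r * (3 * real r + 1) - 1) / (8 * 16 ^ r) * real n powr (1/2))
          = u n + v n + B * t n + (3 * A - C)"
    using eventually_ge_at_top[of 2]
  proof eventually_elim
    case (elim n)
    have pow: "(16::real) ^ r = 4 ^ r * 4 ^ r" "(4::real) ^ r = 2 ^ r * 2 ^ r"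
      by (simp_all flip: power_mult_distrib)
    \<comment> \<open>In \<open>c2\<close> and \<open>c1\<close> the contributions of
      \<open>y\<close> are \<open>2 * A\<close> and \<open>C - 5 * A\<close>; the rest comes from
      \<open>e - e ^ 2\<close>.\<close>
    have c2: "(2 ^ r + 1) * (2 ^ r - 1) / 16 ^ r = 2 * A - \<alpha>\<^sup>2"
      unfolding A_def \<alpha>_def pow by (simp add: field_simps power2_eq_square)
    have c1: "(18 * 4 ^ r * real r ^ 2 + 3 * 4 ^ r * real r - 38 * 4 ^ r
                    + 36 * real r ^ 2 - 42 * real r + 38) / (18 * 16 ^ r) = \<alpha> - 2 * \<alpha> * \<beta> - 5 * A + C"
      unfolding A_def C_def \<alpha>_def \<beta>_def pow(1) by (simp add: field_simps power2_eq_square)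
    have cs: "sqrt pi * (4 ^ r * (3 * real r + 1) - 1) / (3 * 16 ^ r) = - (B * sqrt pi)"
      "5 * sqrt pi * (4 ^ r * (3 * real r + 1) - 1) / (8 * 16 ^ r) = - (15 / 8 * (B * sqrt pi))"
      unfolding B_def by (simp_all add: field_simps)
    have en: "e n = \<alpha> * real n + \<beta> + \<delta> n" by (simp add: \<delta>_def)
    have var: "measure_pmf.variance (random_cs_tree n) (ancestor_size r) = e n - (e n)\<^sup>2 + y n"
      using random_cs_tree_moments(2)[OF elim] by (simp add: e_def y_def)
    show ?case
      unfolding c2 c1 cs var en u_def v_def t_def by (simp add: power2_eq_square algebra_simps)
  qed
  ultimately show "(\<lambda>n. measure_pmf.variance (random_cs_tree n) (ancestor_size r)
            - ((2 ^ r + 1) * (2 ^ r - 1) / 16 ^ r * real n ^ 2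
               - sqrt pi * (4 ^ r * (3 * real r + 1) - 1) / (3 * 16 ^ r) * real n powr (3/2)
               + (18 * 4 ^ r * real r ^ 2 + 3 * 4 ^ r * real r - 38 * 4 ^ r
                    + 36 * real r ^ 2 - 42 * real r + 38) / (18 * 16 ^ r) * real n
               + 5 * sqrt pi * (4 ^ r * (3 * real r + 1) - 1) / (8 * 16 ^ r) * real n powr (1/2))) \<in> O(\<lambda>n. 1)"
    by (simp only: landau_o.big.in_cong)
qed

end
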